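(* Let $K$ be an algebraically closed field of characteristic $2$. There is no classical type simple Lie $2$-algebra over $K$ whose toral rank is odd.
   Context: All Lie algebras are finite-dimensional over $K$. Lie $2$-algebra: a Lie algebra $\mathfrak g$ with a map $[2]:\mathfrak g\to\mathfrak g$, $a\mapsto a^{[2]}$, such that $(a+b)^{[2]}=a^{[2]}+b^{[2]}+[a,b]$, $(\mu a)^{[2]}=\mu^2a^{[2]}$ and $\mathrm{ad}(a^{[2]})=(\mathrm{ad}\,a)^2$ for all $a,b\in\mathfrak g$, $\mu\in K$. If the center of $\mathfrak g$ is zero, such a map is unique if it exists. A simple Lie $2$-algebra is a Lie $2$-algebra whose underlying Lie algebra is simple. Torus: a subalgebra $\mathfrak t$ of $(\mathfrak g,[2])$ on which the map $[2]$ is invertible (such a subalgebra is abelian and has a basis of elements $t$ with $t^{[2]}=t$). The toral rank of $(\mathfrak g,[2])$ is $MT(\mathfrak g)=\max\{\dim_K\mathfrak t : \mathfrak t \text{ a torus in }\mathfrak g\}$. Classical Lie algebra of type $X_l$: for an irreducible root system of type $X_l\in\{A_l,B_l,C_l,D_l,\mathfrak g_2,\mathfrak f_4,\mathfrak e_6,\mathfrak e_7,\mathfrak e_8\}$, let $\mathfrak g(X_l,K)$ be the Chevalley algebra over $K$ (the $\mathbb Z$-span of a Chevalley basis of the complex simple Lie algebra of type $X_l$, tensored with $K$). The classical Lie algebra of type $X_l$ is $\overline{\mathfrak g(X_l,K)}=\mathfrak g(X_l,K)/\mathfrak z(\mathfrak g(X_l,K))$, where $\mathfrak z$ denotes the center.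 A classical type simple Lie $2$-algebra is a simple Lie $2$-algebra of the form $\overline{\mathfrak g(X_l,K)}$. *)

theory Defs
  imports Complex_Main "HOL-Computational_Algebra.Computational_Algebra"
begin

text \<open>
  An algebra lives on a whole type, with scalar multiplication as in \<^locale>\<open>vector_space\<close>.
  All Lie algebras are finite-dimensional.
\<close>

locale lie_algebra = vector_space scale
  for scale :: "'k::field \<Rightarrow> 'a::ab_group_add \<Rightarrow> 'a" +
  fixes bracket :: "'a \<Rightarrow> 'a \<Rightarrow> 'a"
  assumes bracket_add_left: "bracket (x + y) z = bracket x z + bracket y z"
    and bracket_add_right: "bracket x (y + z) = bracket x y + bracket x z"
    and bracket_scale_left: "bracket (scale c x) y = scale c (bracket x y)"
    and bracket_scale_right: "bracket x (scale c y) = scale c (bracket x y)"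
    and bracket_self: "bracket x x = 0"
    and jacobi: "bracket x (bracket y z) + bracket y (bracket z x) + bracket z (bracket x y) = 0"
    and finite_dim: "\<exists>B. finite B \<and> span B = UNIV"
begin

definition subalgebra :: "'a set \<Rightarrow> bool" where
  "subalgebra S \<longleftrightarrow> subspace S \<and> (\<forall>x\<in>S. \<forall>y\<in>S. bracket x y \<in> S)"

definition lie_ideal :: "'a set \<Rightarrow> bool" where
  "lie_ideal I \<longleftrightarrow> subspace I \<and> (\<forall>x. \<forall>y\<in>I. bracket x y \<in> I)"

definition center :: "'a set" where
  "center = {z. \<forall>x. bracket z x = 0}"

definition simple :: bool where
  "simple \<longleftrightarrow> (\<exists>x y. bracket x y \<noteq> 0) \<and> (\<forall>I. lie_ideal I \<longrightarrow> I = {0} \<or> I = UNIV)"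

primrec lower_central :: "'a set \<Rightarrow> nat \<Rightarrow> 'a set" where
  "lower_central S 0 = S"
| "lower_central S (Suc n) = span {bracket x y |x y. x \<in> S \<and> y \<in> lower_central S n}"

definition nilpotent :: "'a set \<Rightarrow> bool" where
  "nilpotent S \<longleftrightarrow> (\<exists>n. lower_central S n = {0})"

definition normalizer :: "'a set \<Rightarrow> 'a set" where
  "normalizer S = {x. \<forall>y\<in>S. bracket x y \<in> S}"

definition cartan_subalgebra :: "'a set \<Rightarrow> bool" where
  "cartan_subalgebra H \<longleftrightarrow> subalgebra H \<and> nilpotent H \<and> normalizer H = H"

text \<open>
  A linear form on a subspace \<open>H\<close> is represented by its extension by \<open>0\<close> outside \<open>H\<close>
  (which is not linear on the whole space), so that equality of forms is equality of functions.
\<close>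

definition linear_forms :: "'a set \<Rightarrow> ('a \<Rightarrow> 'k) set" where
  "linear_forms H = {\<alpha>. (\<forall>x\<in>H. \<forall>y\<in>H. \<alpha> (x + y) = \<alpha> x + \<alpha> y) \<and>
     (\<forall>c. \<forall>x\<in>H. \<alpha> (scale c x) = c * \<alpha> x) \<and> (\<forall>x. x \<notin> H \<longrightarrow> \<alpha> x = 0)}"

definition weight_space :: "'a set \<Rightarrow> ('a \<Rightarrow> 'k) \<Rightarrow> 'a set" where
  "weight_space H \<alpha> = {x. \<forall>t\<in>H. bracket t x = scale (\<alpha> t) x}"

definition roots :: "'a set \<Rightarrow> ('a \<Rightarrow> 'k) set" where
  "roots H = {\<alpha> \<in> linear_forms H. \<alpha> \<noteq> (\<lambda>_. 0) \<and> weight_space H \<alpha> \<noteq> {0}}"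

text \<open>A base \<open>a 1, \<dots>, a l\<close> of the root system.\<close>

definition root_base :: "'a set \<Rightarrow> nat \<Rightarrow> (nat \<Rightarrow> 'a \<Rightarrow> 'k) \<Rightarrow> bool" where
  "root_base H l a \<longleftrightarrow>
     a ` {1..l} \<subseteq> roots H \<and>
     (\<forall>c. (\<forall>t. (\<Sum>i=1..l. c i * a i t) = 0) \<longrightarrow> (\<forall>i\<in>{1..l}. c i = 0)) \<and>
     (\<forall>\<alpha>\<in>roots H. \<exists>n :: nat \<Rightarrow> nat.
        \<alpha> = (\<lambda>t. \<Sum>i=1..l. of_nat (n i) * a i t) \<or>
        \<alpha> = (\<lambda>t. - (\<Sum>i=1..l. of_nat (n i) * a i t)))"

text \<open>The largest \<open>p\<close> such that \<open>\<beta> - p\<alpha>\<close> is a root.\<close>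

definition string_length :: "'a set \<Rightarrow> ('a \<Rightarrow> 'k) \<Rightarrow> ('a \<Rightarrow> 'k) \<Rightarrow> nat" where
  "string_length H \<alpha> \<beta> = Max {p. (\<lambda>t. \<beta> t - of_nat p * \<alpha> t) \<in> roots H}"

definition int_span :: "'a set \<Rightarrow> 'a set" where
  "int_span B = range (\<lambda>n :: 'a \<Rightarrow> int. \<Sum>b\<in>B. scale (of_int (n b)) b)"

end

text \<open>Types of irreducible root systems, with the usual restrictions on the rank.\<close>

datatype root_type = TypeA nat | TypeB nat | TypeC nat | TypeD nat | TypeG2 | TypeF4 | TypeE6 | TypeE7 | TypeE8

fun valid_type :: "root_type \<Rightarrow> bool" where
  "valid_type (TypeA l) = (l \<ge> 1)"
| "valid_type (TypeB l) = (l \<ge> 2)"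
| "valid_type (TypeC l) = (l \<ge> 3)"
| "valid_type (TypeD l) = (l \<ge> 4)"
| "valid_type _ = True"

fun rank :: "root_type \<Rightarrow> nat" where
  "rank (TypeA l) = l"
| "rank (TypeB l) = l"
| "rank (TypeC l) = l"
| "rank (TypeD l) = l"
| "rank TypeG2 = 2"
| "rank TypeF4 = 4"
| "rank TypeE6 = 6"
| "rank TypeE7 = 7"
| "rank TypeE8 = 8"

text \<open>
  The edges of the Dynkin diagram, in Bourbaki's numbering of the vertices \<open>1, \<dots>, l\<close>;
  each edge is listed with its smaller vertex first.
\<close>

fun dynkin_edge :: "root_type \<Rightarrow> nat \<Rightarrow> nat \<Rightarrow> bool" where
  "dynkin_edge (TypeD l) i j = (j = i + 1 \<and> j < l \<or> i + 2 = l \<and> j = l)"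
| "dynkin_edge TypeE6 i j = ((i, j) \<in> {(1,3), (3,4), (2,4), (4,5), (5,6)})"
| "dynkin_edge TypeE7 i j = ((i, j) \<in> {(1,3), (3,4), (2,4), (4,5), (5,6), (6,7)})"
| "dynkin_edge TypeE8 i j = ((i, j) \<in> {(1,3), (3,4), (2,4), (4,5), (5,6), (6,7), (7,8)})"
| "dynkin_edge X i j = (j = i + 1)"

text \<open>
  The entry \<open>(i, j)\<close> of the Cartan matrix is \<open>\<langle>\<alpha>\<^sub>i, \<alpha>\<^sub>j\<rangle> = 2(\<alpha>\<^sub>i, \<alpha>\<^sub>j)/(\<alpha>\<^sub>j, \<alpha>\<^sub>j) = \<alpha>\<^sub>i(h\<^sub>j)\<close>, so it is
  smaller than \<open>-1\<close> when \<open>\<alpha>\<^sub>i\<close> is long and \<open>\<alpha>\<^sub>j\<close> is a short neighbour.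
\<close>

fun multiple_entry :: "root_type \<Rightarrow> nat \<Rightarrow> nat \<Rightarrow> int option" where
  "multiple_entry (TypeB l) i j = (if i + 1 = l \<and> j = l then Some (- 2) else None)"
| "multiple_entry (TypeC l) i j = (if i = l \<and> j + 1 = l then Some (- 2) else None)"
| "multiple_entry TypeF4 i j = (if i = 2 \<and> j = 3 then Some (- 2) else None)"
| "multiple_entry TypeG2 i j = (if i = 2 \<and> j = 1 then Some (- 3) else None)"
| "multiple_entry X i j = None"

definition cartan_matrix :: "root_type \<Rightarrow> nat \<Rightarrow> nat \<Rightarrow> int" where
  "cartan_matrix X i j =
     (if i = j then 2
      else case multiple_entry X i j of
             Some m \<Rightarrow> m
           | None \<Rightarrow> if dynkin_edge X i j \<or> dynkin_edge X j i then - 1 else 0)"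

text \<open>
  \<open>chevalley_basis X H a e B\<close>: with respect to the Cartan subalgebra \<open>H\<close> and the base \<open>a\<close> of its
  root system, which is of type \<open>X\<close>, the vectors \<open>h\<^sub>i = [e\<^sub>\<alpha>, e\<^sub>-\<^sub>\<alpha>]\<close> (\<open>\<alpha> = a i\<close>) and
  \<open>e\<^sub>\<alpha>\<close> (\<open>\<alpha>\<close> a root) form the Chevalley basis \<open>B\<close>. The condition \<open>\<alpha>([e\<^sub>\<alpha>, e\<^sub>-\<^sub>\<alpha>]) = 2\<close> says that
  \<open>[e\<^sub>\<alpha>, e\<^sub>-\<^sub>\<alpha>]\<close> is the coroot of \<open>\<alpha>\<close>, and \<open>p\<close> in \<open>[e\<^sub>\<alpha>, e\<^sub>\<beta>] = \<plusminus>(p + 1) e\<^sub>\<alpha>\<^sub>+\<^sub>\<beta>\<close> is the largest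
  integer for which \<open>\<beta> - p\<alpha>\<close> is a root. The last clause (all structure constants are integers)
  follows from the others by Chevalley's theorem.
\<close>

definition (in lie_algebra) chevalley_basis ::
  "root_type \<Rightarrow> 'a set \<Rightarrow> (nat \<Rightarrow> 'a \<Rightarrow> 'k) \<Rightarrow> (('a \<Rightarrow> 'k) \<Rightarrow> 'a) \<Rightarrow> 'a set \<Rightarrow> bool" where
  "chevalley_basis X H a e B \<longleftrightarrow>
     (let \<Phi> = roots H; h = (\<lambda>\<alpha>. bracket (e \<alpha>) (e (\<lambda>t. - \<alpha> t))) in
        cartan_subalgebra H \<and>
        root_base H (rank X) a \<and>
        (\<forall>i\<in>{1..rank X}. \<forall>j\<in>{1..rank X}. a i (h (a j)) = of_int (cartan_matrix X i j)) \<and>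
        B = (\<lambda>i. h (a i)) ` {1..rank X} \<union> e ` \<Phi> \<and>
        independent B \<and> span B = UNIV \<and>
        (\<forall>\<alpha>\<in>\<Phi>. e \<alpha> \<in> weight_space H \<alpha>) \<and>
        (\<forall>\<alpha>\<in>\<Phi>. h \<alpha> \<in> H \<and> \<alpha> (h \<alpha>) = 2) \<and>
        (\<forall>\<alpha>\<in>\<Phi>. \<forall>\<beta>\<in>\<Phi>. (\<lambda>t. \<alpha> t + \<beta> t) \<in> \<Phi> \<longrightarrow>
           (\<exists>\<epsilon>\<in>{1, - 1}. bracket (e \<alpha>) (e \<beta>) =
              scale (\<epsilon> * of_nat (string_length H \<alpha> \<beta> + 1)) (e (\<lambda>t. \<alpha> t + \<beta> t)))) \<and>
        (\<forall>x\<in>B. \<forall>y\<in>B. bracket x y \<in> int_span B))"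

text \<open>
  The Chevalley algebra of type \<open>X\<close> over the field of \<open>scale\<close>, up to isomorphism: \<open>L\<close> is the
  complex simple Lie algebra of type \<open>X\<close>, and \<open>\<iota>\<close> is the map \<open>v \<mapsto> v \<otimes> 1\<close> from the \<open>\<int>\<close>-span of a
  Chevalley basis \<open>B\<close>. It is a homomorphism of Lie rings which carries the \<open>\<int>\<close>-basis \<open>B\<close> bijectively
  to a basis over the field, and this determines the tensor product. The type argument only
  names the type on which \<open>L\<close> lives.
\<close>

definition chevalley_algebra ::
  "'l::ab_group_add itself \<Rightarrow> root_type \<Rightarrow>
   ('k::field \<Rightarrow> 'c::ab_group_add \<Rightarrow> 'c) \<Rightarrow> ('c \<Rightarrow> 'c \<Rightarrow> 'c) \<Rightarrow> bool" where
  "chevalley_algebra L X scale bracket \<longleftrightarrow>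
     lie_algebra scale bracket \<and> valid_type X \<and>
     (\<exists>(scaleL :: complex \<Rightarrow> 'l \<Rightarrow> 'l) bracketL H a e B (\<iota> :: 'l \<Rightarrow> 'c).
        lie_algebra scaleL bracketL \<and> lie_algebra.simple scaleL bracketL \<and>
        lie_algebra.chevalley_basis scaleL bracketL X H a e B \<and>
        (\<forall>x\<in>lie_algebra.int_span scaleL B. \<forall>y\<in>lie_algebra.int_span scaleL B.
           \<iota> (x + y) = \<iota> x + \<iota> y \<and> \<iota> (bracketL x y) = bracket (\<iota> x) (\<iota> y)) \<and>
        inj_on \<iota> B \<and>
        \<not> module.dependent scale (\<iota> ` B) \<and> module.span scale (\<iota> ` B) = UNIV)"

text \<open>
  The classical Lie algebra of type \<open>X\<close>, up to isomorphism: the quotient of the Chevalley algebra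
  (on the type named by the second argument) by its center, with projection \<open>\<pi>\<close>.
\<close>

definition classical_lie_algebra ::
  "'l::ab_group_add itself \<Rightarrow> 'c::ab_group_add itself \<Rightarrow> root_type \<Rightarrow>
   ('k::field \<Rightarrow> 'a::ab_group_add \<Rightarrow> 'a) \<Rightarrow> ('a \<Rightarrow> 'a \<Rightarrow> 'a) \<Rightarrow> bool" where
  "classical_lie_algebra L C X scale bracket \<longleftrightarrow>
     lie_algebra scale bracket \<and>
     (\<exists>(scaleC :: 'k \<Rightarrow> 'c \<Rightarrow> 'c) bracketC \<pi>.
        chevalley_algebra L X scaleC bracketC \<and>
        Vector_Spaces.linear scaleC scale \<pi> \<and>
        (\<forall>x y. \<pi> (bracketC x y) = bracket (\<pi> x) (\<pi> y)) \<and>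
        surj \<pi> \<and> {x. \<pi> x = 0} = lie_algebra.center bracketC)"

locale lie_2_algebra = lie_algebra scale bracket
  for scale :: "'k::field \<Rightarrow> 'a::ab_group_add \<Rightarrow> 'a" and bracket +
  fixes sq :: "'a \<Rightarrow> 'a"
  assumes sq_add: "sq (x + y) = sq x + sq y + bracket x y"
    and sq_scale: "sq (scale c x) = scale (c ^ 2) (sq x)"
    and ad_sq: "bracket (sq x) y = bracket x (bracket x y)"
begin

definition torus :: "'a set \<Rightarrow> bool" where
  "torus T \<longleftrightarrow> subalgebra T \<and> bij_betw sq T T"

definition toral_rank :: nat where
  "toral_rank = Max {dim T |T. torus T}"

end

definition simple_lie_2_algebra ::
  "('k::field \<Rightarrow> 'a::ab_group_add \<Rightarrow> 'a) \<Rightarrow> ('a \<Rightarrow> 'a \<Rightarrow> 'a) \<Rightarrow> ('a \<Rightarrow> 'a) \<Rightarrow> bool" where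
  "simple_lie_2_algebra scale bracket sq \<longleftrightarrow>
     lie_2_algebra scale bracket sq \<and> lie_algebra.simple scale bracket"

end

theory Submission
  imports Defs
begin

text \<open>
  Let \<open>g\<close> be the Chevalley algebra over \<open>K\<close>, \<open>Z\<close> its center, and \<open>T\<close> the image in \<open>g/Z\<close> of the
  span of the coroots. If \<open>g/Z\<close> is simple, then \<open>T\<close> is a torus of maximal dimension and carries
  a nondegenerate alternating form, so that the toral rank \<open>dim T\<close> is even. The argument treats
  all types at once.

  The form. The Killing form of the complex Lie algebra takes integral values on the lattice of
  the Chevalley basis. Divided by the greatest common divisor of these values and reduced modulo
  2 it becomes a nonzero invariant form on \<open>g\<close>, whose radical is an ideal. Simplicity of \<open>g/Z\<close>
  forces this radical to be \<open>Z\<close> (\<open>radical_eq_center\<close>). On the span of the coroots the form is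
  alternating, since at the coroot of \<open>\<alpha>\<close> it takes the value \<open>2 u\<^sub>\<alpha>\<close>, where \<open>u\<^sub>\<alpha>\<close> is its value at
  the root vectors of \<open>\<alpha>\<close> and \<open>-\<alpha>\<close>.

  The roots modulo 2. Nondegeneracy makes all \<open>u\<^sub>\<alpha>\<close> odd, and hence the matrix of Cartan integers
  symmetric modulo 2. If a root \<open>\<alpha>\<close> vanished on \<open>T\<close>, the Cartan integers of \<open>\<alpha>\<close> and any other root
  would all be even; the Cauchy--Schwarz inequality for the Killing form then leaves only roots
  orthogonal to \<open>\<alpha>\<close> besides \<open>\<plusminus>\<alpha>\<close>, and the root vector of \<open>\<alpha>\<close> would be central in \<open>g/Z\<close>. So
  every root is nonzero on \<open>T\<close> (\<open>root_nonzero_mod_2\<close>), and a generic \<open>h\<close> in \<open>T\<close> has \<open>T\<close> as its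
  centralizer.

  Maximality. Every torus \<open>T'\<close> has a generator: an element \<open>t\<close> whose iterated squares
  \<open>t, t\<^bsup>[2]\<^esup>, t\<^bsup>[4]\<^esup>, \<dots>\<close> contain a basis of \<open>T'\<close> (\<open>torus_generator\<close>). For almost every point \<open>x\<close> of
  the line through \<open>t\<close> and \<open>h\<close>, the first \<open>dim T'\<close> iterated squares of \<open>x\<close> are still independent,
  and the centralizer of \<open>x\<close> is still at most as large as that of \<open>h\<close>. It contains the iterated
  squares of \<open>x\<close>, which gives \<open>dim T' \<le> dim T\<close> (\<open>torus_dim_bound\<close>).
\<close>

section \<open>Linear independence is an open condition\<close>

text \<open>
  A vector space under a name of its own, because constants defined in \<^locale>\<open>vector_space\<close>
  itself are shadowed by their instances for real vector spaces.
\<close>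

locale linear_space = vector_space scale
  for scale :: "'k::field \<Rightarrow> 'v::ab_group_add \<Rightarrow> 'v"
begin

definition indep_family :: "'i set \<Rightarrow> ('i \<Rightarrow> 'v) \<Rightarrow> bool" where
  "indep_family I v \<longleftrightarrow> (\<forall>c. (\<Sum>i\<in>I. scale (c i) (v i)) = 0 \<longrightarrow> (\<forall>i\<in>I. c i = 0))"

lemma indep_familyD:
  "indep_family I v \<Longrightarrow> (\<Sum>i\<in>I. scale (c i) (v i)) = 0 \<Longrightarrow> i \<in> I \<Longrightarrow> c i = 0"
  by (auto simp: indep_family_def)

lemma indep_family_nonzero:
  assumes "finite I" "indep_family I v" "j \<in> I"
  shows "v j \<noteq> 0"
proof
  assume "v j = 0"
  then have "(\<Sum>i\<in>I. scale (if i = j then 1 else 0) (v i)) = 0"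
    by (intro sum.neutral) auto
  from indep_familyD[OF assms(2) this assms(3)] show False by simp
qed

lemma indep_family_inj_on:
  assumes "finite I" "indep_family I v"
  shows "inj_on v I"
proof (rule inj_onI, rule ccontr)
  fix i j assume ij: "i \<in> I" "j \<in> I" "v i = v j" "i \<noteq> j"
  let ?c = "\<lambda>k. if k = i then 1 else if k = j then - 1 else (0 :: 'k)"
  have "(\<Sum>k\<in>I. scale (?c k) (v k)) = (\<Sum>k\<in>{i, j}. scale (?c k) (v k))"
    using assms ij by (intro sum.mono_neutral_right) auto
  also have "\<dots> = 0" using ij by simp
  finally have "?c i = 0" by (rule indep_familyD[OF assms(2), of ?c i]) (rule ij(1))
  then show False by simp
qed

lemma indep_family_independent_image:
  assumes "finite I" "indep_family I v"
  shows "independent (v ` I)"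
proof -
  note inj = indep_family_inj_on[OF assms]
  have "u (v i) = 0" if "(\<Sum>x\<in>v ` I. scale (u x) x) = 0" "i \<in> I" for u i
  proof -
    have "(\<Sum>i\<in>I. scale (u (v i)) (v i)) = 0"
      using that(1) by (simp add: sum.reindex[OF inj])
    then show ?thesis using indep_familyD[OF assms(2), of "u \<circ> v"] that(2) by simp
  qed
  then show ?thesis using assms(1) by (auto simp: dependent_finite)
qed

lemma independent_imp_indep_family:
  assumes "finite I" "inj_on v I" "independent (v ` I)"
  shows "indep_family I v"
  unfolding indep_family_def
proof (intro allI impI ballI)
  fix c i assume c: "(\<Sum>i\<in>I. scale (c i) (v i)) = 0" and i: "i \<in> I"
  let ?u = "\<lambda>x. c (the_inv_into I v x)"
  have "(\<Sum>x\<in>v ` I. scale (?u x) x) = (\<Sum>i\<in>I. scale (c i) (v i))"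
    unfolding sum.reindex[OF assms(2)] using assms(2)
    by (intro sum.cong) (auto simp: the_inv_into_f_f)
  then have "?u (v i) = 0"
    using independentD[OF assms(3), of "v ` I" ?u "v i"] assms(1) i c by simp
  then show "c i = 0" using assms(2) i by (simp add: the_inv_into_f_f)
qed

lemma indep_family_card_le_dim:
  assumes "finite I" "indep_family I v" "v ` I \<subseteq> V" "V \<subseteq> span S" "finite S"
  shows "card I \<le> dim V"
proof -
  obtain B where B: "B \<subseteq> V" "independent B" "V \<subseteq> span B" "card B = dim V"
    using basis_exists by blast
  have "finite B"
    using independent_span_bound[OF assms(5) B(2)] B(1) assms(4) by blast
  then have "card (v ` I) \<le> card B"
    using independent_span_bound[OF _ indep_family_independent_image[OF assms(1,2)]] B(3) assms(3)
    by blast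
  then show ?thesis using B(4) card_image[OF indep_family_inj_on[OF assms(1,2)]] by simp
qed

lemma exists_linear_form_one:
  assumes "v \<noteq> 0"
  obtains f where "Vector_Spaces.linear scale (*) f" "f v = 1"
proof
  let ?E = "extend_basis {v}"
  have iv: "independent {v}" using assms by simp
  have "independent ?E" "span ?E = UNIV" "v \<in> ?E"
    using independent_extend_basis[OF iv] span_extend_basis[OF iv] extend_basis_superset[OF iv]
    by auto
  then show "Vector_Spaces.linear scale (*) (\<lambda>w. representation ?E w v)"
    and "representation ?E v v = 1"
    by (auto intro: linear_representation simp: representation_basis)
qed

text \<open>
  Vector-valued polynomials in one scalar variable. The inductive presentation makes the closure
  properties below plain inductions, without any bookkeeping of coefficients.
\<close>

inductive polymap :: "('k \<Rightarrow> 'v) \<Rightarrow> bool" where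
  const: "polymap (\<lambda>_. v)"
| add: "polymap p \<Longrightarrow> polymap q \<Longrightarrow> polymap (\<lambda>l. p l + q l)"
| scale_var: "polymap p \<Longrightarrow> polymap (\<lambda>l. scale l (p l))"

lemma polymap_scale_const: "polymap p \<Longrightarrow> polymap (\<lambda>l. scale c (p l))"
proof (induction rule: polymap.induct)
  case (scale_var p)
  then show ?case using polymap.scale_var[OF scale_var.IH] by (simp add: mult.commute)
qed (auto intro: polymap.intros simp: scale_right_distrib)

lemma polymap_scale_poly: "polymap p \<Longrightarrow> polymap (\<lambda>l. scale (poly P l) (p l))"
proof (induction P)
  case 0
  then show ?case using polymap.const[of 0] by simp
next
  case (pCons a P)
  have "polymap (\<lambda>l. scale a (p l) + scale l (scale (poly P l) (p l)))"
    using pCons by (intro polymap.add polymap.scale_var polymap_scale_const) auto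
  then show ?case by (simp add: scale_left_distrib)
qed

lemma polymap_diff: "polymap p \<Longrightarrow> polymap q \<Longrightarrow> polymap (\<lambda>l. p l - q l)"
  using polymap.add[of p "\<lambda>l. scale (- 1) (q l)"] polymap_scale_const[of q "- 1"] by simp

lemma linear_form_polymap:
  assumes "Vector_Spaces.linear scale (*) f" "polymap p"
  shows "\<exists>P. \<forall>l. f (p l) = poly P l"
proof -
  interpret f: Vector_Spaces.linear scale "(*)" f by fact
  show ?thesis
    using assms(2)
  proof (induction rule: polymap.induct)
    case (const v)
    show ?case by (rule exI[of _ "[:f v:]"]) simp
  next
    case (add p q)
    then obtain P Q where "\<forall>l. f (p l) = poly P l" "\<forall>l. f (q l) = poly Q l" by blast
    then show ?case by (intro exI[of _ "P + Q"]) (simp add: f.add)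
  next
    case (scale_var p)
    then obtain P where "\<forall>l. f (p l) = poly P l" by blast
    then show ?case by (intro exI[of _ "pCons 0 P"]) (simp add: f.scale)
  qed
qed

text \<open>
  Independence of finitely many polynomial vectors is the nonvanishing of some minor, so it holds
  for almost all parameters once it holds for one. Instead of minors the induction performs a step
  of Gaussian elimination: a linear form \<open>f\<close> that is \<open>1\<close> on the pivot \<open>v j\<close> at the parameter
  \<open>l0\<close> serves to clear the pivot from the other vectors.
\<close>

lemma indep_family_generic:
  assumes "finite I" "\<And>i. i \<in> I \<Longrightarrow> polymap (v i)" "indep_family I (\<lambda>i. v i l0)"
  shows "finite {l. \<not> indep_family I (\<lambda>i. v i l)}"
  using assms
proof (induction I arbitrary: v rule: finite_induct)
  case empty
  then show ?case by (simp add: indep_family_def)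
next
  case (insert j I)
  have "v j l0 \<noteq> 0"
    using indep_family_nonzero[OF _ insert.prems(2), of j] insert.hyps(1) by simp
  then obtain f where f: "Vector_Spaces.linear scale (*) f" "f (v j l0) = 1"
    using exists_linear_form_one by blast
  interpret f: Vector_Spaces.linear scale "(*)" f by (rule f(1))
  have "\<forall>i\<in>insert j I. \<exists>P. \<forall>l. f (v i l) = poly P l"
    using linear_form_polymap[OF f(1)] insert.prems(1) by blast
  then obtain P where P: "\<And>i l. i \<in> insert j I \<Longrightarrow> f (v i l) = poly (P i) l" by metis
  define w where "w i l = scale (poly (P j) l) (v i l) - scale (poly (P i) l) (v j l)" for i l
  have sum_w: "(\<Sum>i\<in>I. scale (c i) (w i l)) =
      (\<Sum>i\<in>insert j I. scale (if i = j then - (\<Sum>k\<in>I. c k * poly (P k) l) else poly (P j) l * c i) (v i l))"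
    for c l
  proof -
    have *: "(\<Sum>i\<in>I. scale (if i = j then - (\<Sum>k\<in>I. c k * poly (P k) l) else poly (P j) l * c i) (v i l))
      = (\<Sum>i\<in>I. scale (poly (P j) l * c i) (v i l))"
      using insert.hyps(2) by (intro sum.cong) auto
    show ?thesis
      unfolding w_def using insert.hyps
      by (simp add: * scale_right_diff_distrib sum_subtractf scale_sum_left mult.commute)
  qed
  have "indep_family I (\<lambda>i. w i l0)"
    unfolding indep_family_def
  proof (intro allI impI ballI)
    fix c i assume i: "i \<in> I" and "(\<Sum>i\<in>I. scale (c i) (w i l0)) = 0"
    from this(2) have "(if i = j then - (\<Sum>k\<in>I. c k * poly (P k) l0) else poly (P j) l0 * c i) = 0"
      unfolding sum_w
      by (rule indep_familyD[OF insert.prems(2), of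
          "\<lambda>i. if i = j then - (\<Sum>k\<in>I. c k * poly (P k) l0) else poly (P j) l0 * c i" i])
        (simp add: i)
    then have "poly (P j) l0 * c i = 0" using i insert.hyps(2) by (auto split: if_splits)
    then show "c i = 0" using f(2) P[of j l0] by simp
  qed
  moreover have "polymap (w i)" if "i \<in> I" for i
    unfolding w_def using insert.prems(1) that by (intro polymap_diff polymap_scale_poly) auto
  ultimately have fin: "finite {l. \<not> indep_family I (\<lambda>i. w i l)}"
    using insert.IH by blast
  have "poly (P j) l0 = 1" using f(2) P[of j l0] by simp
  then have "P j \<noteq> 0" by auto
  then have fin': "finite {l. poly (P j) l = 0}" by (rule poly_roots_finite)
  have "indep_family (insert j I) (\<lambda>i. v i l)"
    if ind: "indep_family I (\<lambda>i. w i l)" and nz: "poly (P j) l \<noteq> 0" for l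
    unfolding indep_family_def
  proof (intro allI impI)
    fix c assume c: "(\<Sum>i\<in>insert j I. scale (c i) (v i l)) = 0"
    have "f (\<Sum>i\<in>insert j I. scale (c i) (v i l)) = (\<Sum>i\<in>insert j I. c i * poly (P i) l)"
      by (simp add: f.sum f.scale P)
    then have "c j * poly (P j) l = - (\<Sum>k\<in>I. c k * poly (P k) l)"
      using c insert.hyps by (simp add: f.zero eq_neg_iff_add_eq_0)
    then have "(\<Sum>i\<in>I. scale (c i) (w i l)) =
        (\<Sum>i\<in>insert j I. scale (poly (P j) l) (scale (c i) (v i l)))"
      unfolding sum_w by (intro sum.cong) (auto simp: mult.commute)
    also have "\<dots> = 0" using c by (simp add: scale_sum_right[symmetric] del: sum.insert scale_scale)
    finally have cI: "\<forall>i\<in>I. c i = 0" using indep_familyD[OF ind, of c] by simp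
    with \<open>c j * poly (P j) l = - (\<Sum>k\<in>I. c k * poly (P k) l)\<close> nz have "c j = 0" by simp
    with cI show "\<forall>i\<in>insert j I. c i = 0" by simp
  qed
  then have "{l. \<not> indep_family (insert j I) (\<lambda>i. v i l)} \<subseteq>
      {l. \<not> indep_family I (\<lambda>i. w i l)} \<union> {l. poly (P j) l = 0}" by blast
  then show ?case using fin fin' finite_subset by blast
qed

end

sublocale lie_algebra \<subseteq> linear_space ..

section \<open>Nondegenerate alternating forms\<close>

context linear_space
begin

lemma bilinear_vanishes_on_span:
  assumes "\<And>x y z. \<omega> (x + y) z = \<omega> x z + (\<omega> y z :: 'k)" "\<And>c x y. \<omega> (scale c x) y = c * \<omega> x y"
    and "\<And>x. x \<in> S \<Longrightarrow> \<omega> x z = 0" "x \<in> span S"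
  shows "\<omega> x z = 0"
  using assms(4)
proof (induction rule: span_induct_alt)
  case base
  show ?case using assms(2)[of 0 0 z] by simp
next
  case (step c x y)
  then show ?case using assms(1,2,3) by simp
qed

text \<open>
  A hyperbolic plane splits off: the orthogonal complement of \<open>x, y\<close> with \<open>\<omega> x y = 1\<close> is again
  nondegenerate, and its dimension is smaller by \<open>2\<close>.
\<close>

lemma nondegenerate_alternating_even_dim:
  assumes fin: "finite S" "U \<subseteq> span S" and sub: "subspace U"
    and add_l: "\<And>x y z. \<omega> (x + y) z = \<omega> x z + (\<omega> y z :: 'k)"
    and add_r: "\<And>x y z. \<omega> z (x + y) = \<omega> z x + \<omega> z y"
    and scale_l: "\<And>c x y. \<omega> (scale c x) y = c * \<omega> x y"
    and scale_r: "\<And>c x y. \<omega> x (scale c y) = c * \<omega> x y"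
    and alt: "\<And>x. x \<in> U \<Longrightarrow> \<omega> x x = 0"
    and nondeg: "\<And>x. x \<in> U \<Longrightarrow> x \<noteq> 0 \<Longrightarrow> \<exists>y\<in>U. \<omega> x y \<noteq> 0"
  shows "even (dim U)"
proof -
  have diff_l: "\<omega> (x - y) z = \<omega> x z - \<omega> y z" for x y z
    using add_l[of "x - y" y z] by simp
  have diff_r: "\<omega> z (x - y) = \<omega> z x - \<omega> z y" for x y z
    using add_r[of z "x - y" y] by simp
  have "\<exists>B. finite B \<and> independent B \<and> span B = U \<and> even (card B)"
    using fin(2) sub alt nondeg
  proof (induction "dim U" arbitrary: U rule: less_induct)
    case less
    show ?case
    proof (cases "U = {0}")
      case True
      then show ?thesis using independent_empty by (intro exI[of _ "{}"]) simp
    next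
      case False
      then obtain x where x: "x \<in> U" "x \<noteq> 0" using subspace_0[OF less.prems(2)] by blast
      then obtain y0 where y0: "y0 \<in> U" "\<omega> x y0 \<noteq> 0" using less.prems(4) by blast
      define y where "y = scale (1 / \<omega> x y0) y0"
      have y: "y \<in> U" "\<omega> x y = 1"
        using y0 less.prems(2) by (auto simp: y_def scale_r subspace_scale)
      have anti: "\<omega> v u = - \<omega> u v" if "u \<in> U" "v \<in> U" for u v
        using less.prems(3)[of "u + v"] less.prems(3)[OF that(1)] less.prems(3)[OF that(2)]
          subspace_add[OF less.prems(2) that]
        by (simp add: add_l add_r eq_neg_iff_add_eq_0 add.commute)
      have yx: "\<omega> y x = - 1" using anti[OF x(1) y(1)] y(2) by simp
      have xx: "\<omega> x x = 0" and yy: "\<omega> y y = 0" using less.prems(3) x y by auto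
      define U' where "U' = {u \<in> U. \<omega> x u = 0 \<and> \<omega> y u = 0}"
      have z0: "\<omega> z 0 = 0" for z using scale_r[of z 0 0] by simp
      have sub': "subspace U'"
        using less.prems(2) unfolding subspace_def U'_def by (auto simp: add_r scale_r z0)
      have U'_le: "U' \<subseteq> U" by (auto simp: U'_def)
      obtain C where C: "C \<subseteq> U'" "independent C" "U' \<subseteq> span C" "card C = dim U'"
        using basis_exists by blast
      have spC: "span C = U'"
        using C(1,3) sub' span_minimal by blast
      have finC: "finite C"
        using independent_span_bound[OF fin(1) C(2)] C(1) U'_le less.prems(1) by blast
      have "x \<notin> span C" using yx by (simp add: spC U'_def)
      then have "independent (insert x C)" using C(2) independent_insertI by blast
      moreover obtain D where D: "D \<subseteq> U" "independent D" "U \<subseteq> span D" "card D = dim U"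
        using basis_exists by blast
      moreover have "finite D"
        using independent_span_bound[OF fin(1) D(2)] D(1) less.prems(1) by blast
      ultimately have "card (insert x C) \<le> dim U"
        using independent_span_bound[of D "insert x C"] x(1) C(1) U'_le
        by (metis insert_subset order_trans)
      then have "dim U' < dim U"
        using C(4) finC \<open>x \<notin> span C\<close> by (subst (asm) card_insert_disjoint) (auto dest: span_base)
      moreover have "\<exists>v\<in>U'. \<omega> u v \<noteq> 0" if u: "u \<in> U'" "u \<noteq> 0" for u
      proof -
        obtain v where v: "v \<in> U" "\<omega> u v \<noteq> 0" using less.prems(4) u U'_le by blast
        \<comment> \<open>the projection of \<open>v\<close> to the orthogonal complement of \<open>x\<close> and \<open>y\<close>\<close>
        let ?v = "v - scale (\<omega> x v) y + scale (\<omega> y v) x"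
        have "?v \<in> U"
          using v(1) x(1) y(1) less.prems(2) by (intro subspace_add subspace_diff subspace_scale)
        then have "?v \<in> U'"
          by (simp add: U'_def add_r diff_r scale_r y(2) yx xx yy)
        moreover have "\<omega> u x = 0" "\<omega> u y = 0"
          using u(1) anti[of x u] anti[of y u] x y by (auto simp: U'_def)
        then have "\<omega> u ?v \<noteq> 0" using v(2) by (simp add: add_r diff_r scale_r)
        ultimately show ?thesis by blast
      qed
      ultimately obtain B where B: "finite B" "independent B" "span B = U'" "even (card B)"
        using less.hyps[of U'] sub' U'_le less.prems by blast
      have yB: "y \<notin> span B" using y(2) by (simp add: B(3) U'_def)
      have xB: "x \<notin> span (insert y B)"
        unfolding span_insert
        by (auto simp: B(3) U'_def diff_r scale_r yx yy)
      have "y \<notin> B" "x \<notin> insert y B" using yB xB span_base by blast+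
      then have "even (card (insert x (insert y B)))" using B(1,4) by simp
      moreover have "independent (insert x (insert y B))"
        using B(2) yB xB by (intro independent_insertI)
      moreover have "span (insert x (insert y B)) = U"
      proof
        have "B \<subseteq> U" using B(3) U'_le span_superset by blast
        then show "span (insert x (insert y B)) \<subseteq> U"
          using x(1) y(1) less.prems(2) by (intro span_minimal) auto
        show "U \<subseteq> span (insert x (insert y B))"
        proof
          fix v assume v: "v \<in> U"
          let ?v = "v - scale (\<omega> x v) y + scale (\<omega> y v) x"
          have "?v \<in> U"
            using v x(1) y(1) less.prems(2) by (intro subspace_add subspace_diff subspace_scale)
          then have "?v \<in> span B"
            unfolding B(3) by (simp add: U'_def add_r diff_r scale_r y(2) yx xx yy)
          then have "?v \<in> span (insert x (insert y B))"
            using span_mono[of B "insert x (insert y B)"] by blast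
          then have "?v + scale (\<omega> x v) y - scale (\<omega> y v) x \<in> span (insert x (insert y B))"
            by (rule span_diff[OF span_add]) (auto intro: span_base span_scale)
          moreover have "?v + scale (\<omega> x v) y - scale (\<omega> y v) x = v" by (simp add: algebra_simps)
          ultimately show "v \<in> span (insert x (insert y B))" by simp
        qed
      qed
      ultimately show ?thesis using B(1) by (intro exI[of _ "insert x (insert y B)"]) auto
    qed
  qed
  then obtain B where "independent B" "span B = U" "even (card B)" by blast
  then show ?thesis using dim_span_eq_card_independent[of B] by simp
qed

end

section \<open>Polynomials over an algebraically closed field\<close>

lemma infinite_UNIV_alg_closed: "infinite (UNIV :: 'k::alg_closed_field set)"
proof
  assume fin: "finite (UNIV :: 'k set)"
  let ?p = "(\<Prod>a\<in>UNIV. [:- a, 1:]) + 1 :: 'k poly"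
  have val: "poly ?p x = 1" for x
    using fin by (simp add: poly_prod)
  have "degree ?p \<noteq> 0"
  proof
    assume "degree ?p = 0"
    then obtain c where "?p = [:c:]" by (rule degree_eq_zeroE)
    then have "?p = 1" using val[of 0] by (simp add: one_pCons)
    then have "(\<Prod>a\<in>UNIV. [:- a, 1:]) = (0 :: 'k poly)" by simp
    then show False using fin by simp
  qed
  then show False using alg_closed_imp_poly_has_root[of ?p] val by auto
qed

lemma card_roots_of_separable:
  fixes p :: "'k::alg_closed_field poly"
  assumes "p \<noteq> 0" and sep: "\<And>x. poly p x = 0 \<Longrightarrow> poly (pderiv p) x \<noteq> 0"
  shows "card {x. poly p x = 0} = degree p"
proof -
  obtain A where A: "size A = degree p" "p = smult (lead_coeff p) (\<Prod>x\<in>#A. [:- x, 1:])"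
    using alg_closed_imp_factorization[OF assms(1)] by blast
  have "count A a \<le> 1" for a
  proof (rule ccontr)
    assume "\<not> count A a \<le> 1"
    then have "{#a, a#} \<subseteq># A" by (intro mset_subset_eqI) auto
    then obtain C where "A = {#a, a#} + C" by (metis subset_mset.le_iff_add)
    then obtain q where "p = smult (lead_coeff p) ([:- a, 1:] * ([:- a, 1:] * q))"
      using A(2) by (intro that[of "\<Prod>x\<in>#C. [:- x, 1:]"]) simp
    then obtain r where "p = [:- a, 1:] * ([:- a, 1:] * r)"
      by (metis mult_smult_right)
    then have "poly p a = 0" "poly (pderiv p) a = 0"
      by (simp_all only: pderiv_mult poly_add poly_mult) simp_all
    then show False using sep by blast
  qed
  then have "A = mset_set (set_mset A)"
    by (intro multiset_eqI) (auto simp: count_mset_set' not_in_iff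
        intro!: antisym simp flip: count_greater_zero_iff intro: Suc_leI)
  then have "card (set_mset A) = degree p" using A(1) by (metis size_mset_set)
  moreover have "poly p x = 0 \<longleftrightarrow> x \<in> set_mset A" for x
  proof -
    have "poly p x = lead_coeff p * (\<Prod>a\<in>#A. x - a)"
      by (subst A(2)) (simp add: poly_prod_mset image_mset.compositionality o_def algebra_simps)
    then show ?thesis using assms(1) by auto
  qed
  ultimately show ?thesis by simp
qed

text \<open>
  Each new value avoids the finitely many differences of subset sums of the earlier ones.
\<close>

lemma exists_distinct_subset_sums:
  assumes "finite I"
  shows "\<exists>c :: 'i \<Rightarrow> 'k::alg_closed_field. inj_on (\<lambda>J. \<Sum>i\<in>J. c i) (Pow I)"
  using assms
proof (induction I)
  case empty
  then show ?case by simp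
next
  case (insert j I)
  then obtain c :: "'i \<Rightarrow> 'k" where c: "inj_on (\<lambda>J. \<Sum>i\<in>J. c i) (Pow I)" by blast
  let ?D = "(\<lambda>(J, J'). sum c J - sum c J') ` (Pow I \<times> Pow I)"
  have "finite ?D" using insert.hyps by simp
  then obtain x where x: "x \<notin> ?D" using infinite_UNIV_alg_closed by (metis ex_new_if_finite)
  let ?c = "c(j := x)"
  have same: "sum ?c J = sum c (J - {j}) + (if j \<in> J then x else 0)" if "J \<subseteq> insert j I" for J
  proof -
    have "finite J" using that insert.hyps(1) finite_subset by blast
    moreover have "sum ?c (J - {j}) = sum c (J - {j})" by (intro sum.cong) auto
    ultimately show ?thesis
      by (cases "j \<in> J") (auto simp: sum.remove)
  qed
  have "inj_on (\<lambda>J. sum ?c J) (Pow (insert j I))"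
  proof (rule inj_onI)
    fix J J' assume J: "J \<in> Pow (insert j I)" "J' \<in> Pow (insert j I)" "sum ?c J = sum ?c J'"
    have sub: "J - {j} \<in> Pow I" "J' - {j} \<in> Pow I" using J by auto
    have eq: "sum c (J - {j}) + (if j \<in> J then x else 0) =
        sum c (J' - {j}) + (if j \<in> J' then x else 0)"
      using J same by simp
    have "j \<in> J \<longleftrightarrow> j \<in> J'"
    proof (rule ccontr)
      assume "(j \<in> J) \<noteq> (j \<in> J')"
      then have "x = sum c (J - {j}) - sum c (J' - {j}) \<or> x = sum c (J' - {j}) - sum c (J - {j})"
        using eq by (auto simp: algebra_simps split: if_splits)
      then show False using x sub by auto
    qed
    moreover from this eq have "J - {j} = J' - {j}" using c sub by (auto dest: inj_onD)
    ultimately show "J = J'" by blast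
  qed
  then show ?case by blast
qed

section \<open>Calculations with brackets\<close>

context lie_algebra
begin

lemma bracket_zero_left [simp]: "bracket 0 y = 0"
  using bracket_scale_left[of 0 0 y] by simp

lemma bracket_zero_right [simp]: "bracket x 0 = 0"
  using bracket_scale_right[of x 0 0] by simp

lemma bracket_minus_left: "bracket (- x) y = - bracket x y"
  using bracket_scale_left[of "- 1" x y] by simp

lemma bracket_minus_right: "bracket x (- y) = - bracket x y"
  using bracket_scale_right[of x "- 1" y] by simp

lemma bracket_diff_left: "bracket (x - y) z = bracket x z - bracket y z"
  using bracket_add_left[of x "- y" z] by (simp add: bracket_minus_left)

lemma bracket_diff_right: "bracket z (x - y) = bracket z x - bracket z y"
  using bracket_add_right[of z x "- y"] by (simp add: bracket_minus_right)

lemma bracket_sum_left: "bracket (\<Sum>i\<in>I. f i) y = (\<Sum>i\<in>I. bracket (f i) y)"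
  by (induction I rule: infinite_finite_induct) (auto simp: bracket_add_left)

lemma bracket_sum_right: "bracket y (\<Sum>i\<in>I. f i) = (\<Sum>i\<in>I. bracket y (f i))"
  by (induction I rule: infinite_finite_induct) (auto simp: bracket_add_right)

lemma bracket_anti: "bracket y x = - bracket x y"
  using bracket_self[of "x + y"] unfolding bracket_add_left bracket_add_right
  by (simp add: bracket_self eq_neg_iff_add_eq_0 add.commute)

lemma bracket_derivation: "bracket x (bracket y z) = bracket (bracket x y) z + bracket y (bracket x z)"
proof -
  have "bracket x (bracket y z) = - bracket y (bracket z x) - bracket z (bracket x y)"
    using jacobi[of x y z] by (metis add.assoc add_eq_0_iff2 diff_conv_add_uminus minus_add_distrib)
  then show ?thesis
    by (simp add: bracket_anti[of z x] bracket_anti[of z] bracket_minus_right add.commute)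
qed

lemma bracket_linear: "Vector_Spaces.linear scale scale (bracket x)"
  by unfold_locales (auto simp: bracket_add_right bracket_scale_right)

lemma commutes_with_span: "(\<And>y. y \<in> S \<Longrightarrow> bracket x y = 0) \<Longrightarrow> y \<in> span S \<Longrightarrow> bracket x y = 0"
  by (rotate_tac 1, induction rule: span_induct_alt) (auto simp: bracket_add_right bracket_scale_right)

lemma span_commutes:
  assumes "\<And>x y. x \<in> S \<Longrightarrow> y \<in> S \<Longrightarrow> bracket x y = 0" "x \<in> span S" "y \<in> span S"
  shows "bracket x y = 0"
proof -
  have "bracket y s = 0" if "s \<in> S" for s
    using commutes_with_span[of S s y] assms(1,3) that bracket_anti[of y s] by simp
  then show ?thesis using commutes_with_span[of S y x] assms(2) bracket_anti[of x y] by simp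
qed

lemma finite_dimensional_basis:
  obtains Basis where "finite_dimensional_vector_space scale Basis"
proof -
  obtain S where S: "finite S" "span S = UNIV" using finite_dim by blast
  obtain B where B: "B \<subseteq> S" "independent B" "S \<subseteq> span B"
    using maximal_independent_subset by blast
  have "span B = UNIV" using B(3) S(2) span_minimal subspace_span by blast
  moreover have "finite B" using B(1) S(1) finite_subset by blast
  ultimately show ?thesis using B(2) by (intro that) (unfold_locales, auto)
qed

lemma indep_family_card_le:
  assumes "finite I" "indep_family I v" "v ` I \<subseteq> V"
  shows "card I \<le> dim V"
  using indep_family_card_le_dim[OF assms] finite_dim by (metis subset_UNIV)

end

section \<open>Tori in Lie 2-algebras\<close>

locale lie_2_algebra_closed = lie_2_algebra scale bracket sq
  for scale :: "'k::alg_closed_field \<Rightarrow> 'a::ab_group_add \<Rightarrow> 'a" and bracket sq +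
  assumes char_2: "CHAR('k) = 2"
begin

lemma two_eq_0: "(2 :: 'k) = 0"
  using of_nat_CHAR[where 'a = 'k] by (simp add: char_2)

lemma scalar_add_self: "(c :: 'k) + c = 0"
  using two_eq_0 by (metis mult_2 mult_zero_left)

lemma add_self: "x + x = (0 :: 'a)"
  using scale_left_distrib[of 1 1 x] by (simp add: scalar_add_self)

lemma minus_self: "- x = (x :: 'a)"
  using add_self[of x] by (simp add: neg_eq_iff_add_eq_0)

lemma bracket_commute: "bracket y x = bracket x y"
  using bracket_anti[of y x] by (simp add: minus_self)

lemma exists_scalar_sqrt: "\<exists>d. \<forall>i. d i ^ 2 = (c i :: 'k)"
  using nth_root_exists[of 2] by (intro choice allI) simp

lemma scalar_power_add: "(x + y :: 'k) ^ 2 ^ j = x ^ 2 ^ j + y ^ 2 ^ j"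
  using freshmans_dream'[where 'a = 'k, of "2 ^ j" j x y] by (simp add: char_2)

lemma sq_zero [simp]: "sq 0 = 0"
  using sq_scale[of 0 0] by simp

lemma sq_sum:
  assumes "finite I" "\<And>i j. i \<in> I \<Longrightarrow> j \<in> I \<Longrightarrow> bracket (v i) (v j) = 0"
  shows "sq (\<Sum>i\<in>I. scale (c i) (v i)) = (\<Sum>i\<in>I. scale (c i ^ 2) (sq (v i)))"
  using assms
proof (induction I)
  case (insert j I)
  have "bracket (scale (c j) (v j)) (\<Sum>i\<in>I. scale (c i) (v i)) = 0"
    by (simp add: bracket_sum_right bracket_scale_left bracket_scale_right insert.prems)
  then show ?case using insert by (simp add: sq_add sq_scale)
qed simp

lemma sq_preserves_commuting: "bracket x y = 0 \<Longrightarrow> bracket (sq x) y = 0"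
  by (simp add: ad_sq)

lemma iterates_commute: "bracket ((sq ^^ i) x) ((sq ^^ j) x) = 0"
proof -
  have "bracket ((sq ^^ i) x) x = 0" for i
    by (induction i) (auto simp: bracket_self sq_preserves_commuting)
  then have "bracket ((sq ^^ j) x) ((sq ^^ i) x) = 0" for i j
    by (induction j) (auto intro: sq_preserves_commuting simp: bracket_commute[of x])
  then show ?thesis by blast
qed

lemma torus_iterate: "torus T \<Longrightarrow> y \<in> T \<Longrightarrow> (sq ^^ i) y \<in> T"
  by (induction i) (auto simp: torus_def bij_betw_def)

lemma torus_subspace: "torus T \<Longrightarrow> subspace T"
  by (simp add: torus_def subalgebra_def)

text \<open>
  The minimal relation between the iterates of \<open>y\<close> has a nonzero constant term: otherwise it is
  a relation between the squares of the first \<open>k\<close> iterates, and as scalars have square roots and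
  \<open>sq\<close> is injective on the torus, it would descend to the iterates themselves.
\<close>

lemma torus_minimal_relation:
  assumes T: "torus T" and y: "y \<in> T"
  obtains k a where "indep_family {..<k} (\<lambda>i. (sq ^^ i) y)"
    "(sq ^^ k) y = (\<Sum>i<k. scale (a i) ((sq ^^ i) y))" "k > 0 \<Longrightarrow> a 0 \<noteq> 0"
proof -
  let ?v = "\<lambda>i. (sq ^^ i) y"
  have "\<not> indep_family {..<Suc (dim UNIV)} ?v"
    using indep_family_card_le[of "{..<Suc (dim UNIV)}" ?v UNIV] by auto
  then have ex: "\<exists>n. \<not> indep_family {..<Suc n} ?v" by blast
  define k where "k = (LEAST n. \<not> indep_family {..<Suc n} ?v)"
  have dep: "\<not> indep_family {..<Suc k} ?v"
    unfolding k_def using ex by (rule LeastI_ex)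
  have ind: "indep_family {..<k} ?v"
  proof (cases k)
    case 0
    then show ?thesis by (simp add: indep_family_def)
  next
    case (Suc m)
    then show ?thesis using not_less_Least[of m "\<lambda>n. \<not> indep_family {..<Suc n} ?v"]
      unfolding k_def[symmetric] by auto
  qed
  obtain c where c: "(\<Sum>i<Suc k. scale (c i) (?v i)) = 0" "\<exists>i<Suc k. c i \<noteq> 0"
    using dep unfolding indep_family_def by (auto simp: Bex_def)
  have ck: "c k \<noteq> 0"
  proof
    assume "c k = 0"
    then have "(\<Sum>i<k. scale (c i) (?v i)) = 0" using c(1) by simp
    then have "\<forall>i<k. c i = 0" using indep_familyD[OF ind, of c] by simp
    then show False using c(2) \<open>c k = 0\<close> less_Suc_eq by auto
  qed
  define a where "a i = - (c i / c k)" for i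
  have "?v k = scale (1 / c k) (scale (c k) (?v k))" using ck by simp
  also have "scale (c k) (?v k) = - (\<Sum>i<k. scale (c i) (?v i))"
    using c(1) by (simp add: eq_neg_iff_add_eq_0 add.commute)
  also have "scale (1 / c k) \<dots> = (\<Sum>i<k. scale (a i) (?v i))"
    by (simp add: a_def scale_sum_right sum_negf)
  finally have rel: "?v k = (\<Sum>i<k. scale (a i) (?v i))" .
  have ind': "indep_family {..<k} (\<lambda>i. ?v (Suc i))"
    unfolding indep_family_def
  proof (intro allI impI)
    fix b assume b: "(\<Sum>i<k. scale (b i) (?v (Suc i))) = 0"
    obtain d where d: "\<And>i. d i ^ 2 = b i" using exists_scalar_sqrt[of b] by blast
    have "sq (\<Sum>i<k. scale (d i) (?v i)) = (\<Sum>i<k. scale (b i) (?v (Suc i)))"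
      by (subst sq_sum) (auto simp: iterates_commute d)
    then have "sq (\<Sum>i<k. scale (d i) (?v i)) = sq 0" using b by simp
    moreover have "(\<Sum>i<k. scale (d i) (?v i)) \<in> T" "0 \<in> T"
      using torus_subspace[OF T] torus_iterate[OF T y]
      by (auto intro!: subspace_sum subspace_scale subspace_0)
    ultimately have "(\<Sum>i<k. scale (d i) (?v i)) = 0"
      using T inj_onD[of sq T] unfolding torus_def bij_betw_def by metis
    then have "\<forall>i\<in>{..<k}. d i = 0" using indep_familyD[OF ind, of d] by simp
    then show "\<forall>i\<in>{..<k}. b i = 0" by (simp add: d[symmetric])
  qed
  have "a 0 \<noteq> 0" if pos: "k > 0"
  proof
    assume a0: "a 0 = 0"
    obtain m where m: "k = Suc m" using gr0_implies_Suc[OF pos] by blast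
    have "?v (Suc m) = (\<Sum>i<m. scale (a (Suc i)) (?v (Suc i)))"
      using rel unfolding m sum.lessThan_Suc_shift a0 by simp
    then have "(\<Sum>i<k. scale (if i = m then - 1 else a (Suc i)) (?v (Suc i))) = 0"
      unfolding m by simp
    from indep_familyD[OF ind', of "\<lambda>i. if i = m then - 1 else a (Suc i)", OF this, of m] m
    show False by simp
  qed
  with ind rel show ?thesis by (rule that)
qed

text \<open>
  On the span \<open>W\<close> of the iterates \<open>y\<^sub>i\<close> of \<open>y\<close>, with \<open>y\<^sub>k = \<Sum>i<k. a\<^sub>i y\<^sub>i\<close>, the vector
  \<open>\<Sum>i<k. p\<^sub>i y\<^sub>i\<close> is fixed by \<open>sq\<close> if and only if \<open>p\<^sub>0 = a\<^sub>0 b\<^sup>2\<close> and \<open>p\<^sub>i = p\<^sub>i\<^sub>-\<^sub>1\<^sup>2 + a\<^sub>i b\<^sup>2\<close> for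
  \<open>b = p\<^sub>k\<^sub>-\<^sub>1\<close>. Eliminating leaves one equation for \<open>b\<close> of degree \<open>2\<^sup>k\<close>; its derivative is
  constant, so \<open>W\<close> has \<open>2\<^sup>k\<close> fixed vectors. A fixed vector has coordinates \<open>0\<close> and \<open>1\<close> with
  respect to a basis of fixed vectors, therefore that many fixed vectors span a space of
  dimension at least \<open>k = dim W\<close>.
\<close>

lemma torus_element_in_span_toral:
  assumes T: "torus T" and y: "y \<in> T"
  shows "y \<in> span {z \<in> T. sq z = z}"
proof -
  let ?v = "\<lambda>i. (sq ^^ i) y"
  obtain k a where ind: "indep_family {..<k} ?v" and rel: "?v k = (\<Sum>i<k. scale (a i) (?v i))"
    and a0: "k > 0 \<Longrightarrow> a 0 \<noteq> 0"
    using torus_minimal_relation[OF T y] by blast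
  show ?thesis
  proof (cases k)
    case 0
    then show ?thesis using rel span_zero by simp
  next
    case (Suc m)
    define P where "P = rec_nat [:0, 0, a 0:] (\<lambda>i p. p ^ 2 + [:0, 0, a (Suc i):])"
    have P_0: "P 0 = [:0, 0, a 0:]" and P_Suc: "P (Suc i) = P i ^ 2 + [:0, 0, a (Suc i):]" for i
      by (simp_all add: P_def)
    have deg: "degree (P i) = 2 ^ Suc i" for i
    proof (induction i)
      case 0
      then show ?case using a0 Suc by (simp add: P_0)
    next
      case (Suc i)
      have "P i \<noteq> 0" using Suc by auto
      then have d: "degree (P i ^ 2) = 2 ^ Suc (Suc i)"
        using Suc by (simp add: degree_power_eq)
      have "degree [:0, 0, a (Suc i):] \<le> 2" by simp
      also have "(2 :: nat) < 2 ^ Suc (Suc i)"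
        using power_strict_increasing[of 1 "Suc (Suc i)" "2 :: nat"] by simp
      finally show ?case unfolding P_Suc d[symmetric] by (rule degree_add_eq_left)
    qed
    have two_poly: "(2 :: 'k poly) = 0"
      by (metis two_eq_0 numeral_poly pCons_0_0)
    have der: "pderiv (P i) = 0" for i
      by (induction i)
        (auto simp: P_0 P_Suc pderiv_add pderiv_pCons pderiv_power two_eq_0 power2_eq_square
          pderiv_mult scalar_add_self simp flip: mult_2 simp: two_poly)
    define Q where "Q = P m - [:0, 1:]"
    have degQ: "degree Q = 2 ^ k"
    proof -
      have "degree [:0, 1 :: 'k:] < degree (P m)"
        using one_less_power[of "2 :: nat" "Suc m"] by (simp add: deg del: power_Suc)
      then have "degree Q = degree (P m)"
        unfolding Q_def diff_conv_add_uminus by (intro degree_add_eq_left) simp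
      then show ?thesis by (simp add: deg Suc)
    qed
    have "pderiv Q = - 1" by (simp add: Q_def pderiv_diff der pderiv_pCons one_pCons)
    then have cardR: "card {b. poly Q b = 0} = 2 ^ k"
      using degQ by (subst card_roots_of_separable) (auto simp: Suc)
    define z where "z b = (\<Sum>i<k. scale (poly (P i) b) (?v i))" for b
    have inj: "inj_on z {b. poly Q b = 0}"
    proof (rule inj_onI)
      fix b b' assume b: "b \<in> {b. poly Q b = 0}" "b' \<in> {b. poly Q b = 0}" "z b = z b'"
      then have "(\<Sum>i<k. scale (poly (P i) b - poly (P i) b') (?v i)) = 0"
        by (simp add: z_def scale_left_diff_distrib sum_subtractf)
      from indep_familyD[OF ind, of "\<lambda>i. poly (P i) b - poly (P i) b'", OF this, of m] b show "b = b'" by (simp add: Q_def Suc)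
    qed
    have zT: "z b \<in> T" for b
      unfolding z_def using torus_subspace[OF T] torus_iterate[OF T y]
      by (auto intro!: subspace_sum subspace_scale)
    have fixed: "sq (z b) = z b" if "poly Q b = 0" for b
    proof -
      have b: "poly (P m) b = b" using that by (simp add: Q_def)
      have "sq (z b) = (\<Sum>i<k. scale (poly (P i) b ^ 2) (?v (Suc i)))"
        unfolding z_def by (subst sq_sum) (auto simp: iterates_commute)
      also have "\<dots> = (\<Sum>i<m. scale (poly (P i) b ^ 2) (?v (Suc i))) + scale (b ^ 2) (?v k)"
        by (simp add: Suc b)
      also have "scale (b ^ 2) (?v k) = scale (a 0 * b ^ 2) y
          + (\<Sum>i<m. scale (a (Suc i) * b ^ 2) (?v (Suc i)))"
        unfolding rel unfolding Suc sum.lessThan_Suc_shift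
        by (simp add: scale_right_distrib scale_sum_right mult.commute)
      also have "(\<Sum>i<m. scale (poly (P i) b ^ 2) (?v (Suc i))) + \<dots> = z b"
        unfolding z_def unfolding Suc sum.lessThan_Suc_shift
        by (simp add: P_0 P_Suc scale_left_distrib sum.distrib power2_eq_square algebra_simps)
      finally show ?thesis .
    qed
    define F where "F = z ` {b. poly Q b = 0}"
    have finF: "finite F" and cardF: "card F = 2 ^ k"
      using cardR card_image[OF inj] by (auto simp: F_def intro: card_ge_0_finite)
    let ?W = "span (?v ` {..<k})"
    obtain Basis where "finite_dimensional_vector_space scale Basis"
      using finite_dimensional_basis by blast
    then interpret fd: finite_dimensional_vector_space scale Basis .
    have FW: "F \<subseteq> ?W"
      by (auto simp: F_def z_def intro!: span_sum intro: span_scale span_base)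
    have W_comm: "bracket x x' = 0" if "x \<in> ?W" "x' \<in> ?W" for x x'
      using span_commutes[of "?v ` {..<k}"] that iterates_commute by blast
    obtain I where I: "I \<subseteq> F" "independent I" "F \<subseteq> span I"
      using maximal_independent_subset by blast
    have finI: "finite I" using I(1) finF finite_subset by blast
    have indI: "indep_family I (\<lambda>x. x)"
      using independent_imp_indep_family[of I "\<lambda>x. x"] finI I(2) by simp
    have "F \<subseteq> (\<lambda>J. \<Sum>J) ` Pow I"
    proof
      fix f assume f: "f \<in> F"
      then obtain c where c: "f = (\<Sum>i\<in>I. scale (c i) i)"
        using I(3) span_finite[OF finI] by blast
      have sqi: "sq i = i" if "i \<in> I" for i using that I(1) fixed by (auto simp: F_def)
      have "sq f = (\<Sum>i\<in>I. scale (c i ^ 2) (sq i))"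
        unfolding c using finI I(1) FW W_comm by (intro sq_sum) blast+
      also have "\<dots> = (\<Sum>i\<in>I. scale (c i ^ 2) i)" using sqi by (intro sum.cong) auto
      finally have "(\<Sum>i\<in>I. scale (c i ^ 2 - c i) i) = 0"
        using f fixed c by (auto simp: F_def scale_left_diff_distrib sum_subtractf)
      then have "c i ^ 2 - c i = 0" if "i \<in> I" for i
        using indep_familyD[OF indI, of "\<lambda>i. c i ^ 2 - c i"] that by simp
      then have c01: "c i = 0 \<or> c i = 1" if "i \<in> I" for i
        using that by (metis eq_iff_diff_eq_0 mult_cancel_right1 power2_eq_square)
      have "f = (\<Sum>i\<in>{i \<in> I. c i = 1}. i)"
        unfolding c using finI c01 by (intro sum.mono_neutral_cong_right) auto
      then show "f \<in> (\<lambda>J. \<Sum>J) ` Pow I" by blast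
    qed
    then have "card F \<le> card ((\<lambda>J. \<Sum>J) ` Pow I)" using finI by (intro card_mono) auto
    also have "\<dots> \<le> 2 ^ card I" using finI card_image_le[of "Pow I"] by (simp add: card_Pow)
    finally have "k \<le> card I" by (simp add: cardF)
    moreover have "dim ?W \<le> k"
      using dim_le_card[of ?W "?v ` {..<k}"] card_image_le[of "{..<k}" ?v] by simp
    ultimately have "?W \<subseteq> span I"
      using fd.card_ge_dim_independent[of I ?W] I(1,2) FW by simp
    moreover have "y \<in> ?W" using Suc by (intro span_base image_eqI[of _ _ 0]) auto
    moreover have "I \<subseteq> {z \<in> T. sq z = z}" using I(1) zT fixed by (auto simp: F_def)
    then have "span I \<subseteq> span {z \<in> T. sq z = z}" by (rule span_mono)
    ultimately show ?thesis by blast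
  qed
qed

text \<open>
  For toral \<open>a\<close> and \<open>c = [a, b]\<close> one has \<open>[a, c] = c\<close>, hence \<open>[c, [c, a]] = 0\<close> and all
  iterates of \<open>c\<close> beyond \<open>c\<close> itself commute with \<open>a\<close>. By the minimal relation \<open>c\<close> is a
  combination of these.
\<close>

lemma toral_commutes_with_torus:
  assumes T: "torus T" and ab: "a \<in> T" "b \<in> T" and a: "sq a = a"
  shows "bracket a b = 0"
proof -
  define c where "c = bracket a b"
  have cT: "c \<in> T" using T ab by (simp add: c_def torus_def subalgebra_def)
  have ac: "bracket a c = c" using ad_sq[of a b] a by (simp add: c_def)
  have it: "bracket ((sq ^^ Suc i) c) a = 0" for i
  proof (induction i)
    case 0
    show ?case by (simp add: ad_sq bracket_commute[of c a] ac bracket_self)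
  next
    case (Suc i)
    then show ?case using sq_preserves_commuting by simp
  qed
  obtain k d where rel: "(sq ^^ k) c = (\<Sum>i<k. scale (d i) ((sq ^^ i) c))"
    and d0: "k > 0 \<Longrightarrow> d 0 \<noteq> 0"
    using torus_minimal_relation[OF T cT] by blast
  show ?thesis
  proof (cases k)
    case 0
    then show ?thesis using rel by (simp add: c_def)
  next
    case (Suc m)
    have "0 = bracket ((sq ^^ k) c) a" using it[of m] Suc by simp
    also have "\<dots> = scale (d 0) (bracket c a)"
      unfolding rel unfolding Suc sum.lessThan_Suc_shift
      using it by (simp add: bracket_sum_left bracket_add_left bracket_scale_left del: funpow.simps(2))
    finally have "bracket c a = 0" using d0 Suc by simp
    then show ?thesis using ac bracket_commute[of c a] by (simp add: c_def)
  qed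
qed

text \<open>
  With a toral basis \<open>I\<close> of the torus, the iterates of \<open>\<Sum>i\<in>I. c\<^sub>i i\<close> are \<open>\<Sum>i\<in>I. c\<^sub>i\<^bsup>2^j\<^esup> i\<close>.
  A relation between them gives an additive polynomial of degree less than \<open>2\<^bsup>card I\<^esup>\<close> that
  vanishes at every \<open>c\<^sub>i\<close>, hence at all their subset sums; it is zero if these are distinct.
\<close>

lemma torus_generator:
  assumes T: "torus T"
  obtains t where "t \<in> T" "indep_family {..<dim T} (\<lambda>i. (sq ^^ i) t)"
proof -
  obtain I where I: "I \<subseteq> {z \<in> T. sq z = z}" "independent I" "{z \<in> T. sq z = z} \<subseteq> span I"
    using maximal_independent_subset by blast
  obtain Basis where "finite_dimensional_vector_space scale Basis"
    using finite_dimensional_basis by blast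
  then interpret fd: finite_dimensional_vector_space scale Basis .
  have finI: "finite I" using fd.finiteI_independent I(2) by blast
  have "span {z \<in> T. sq z = z} \<subseteq> span I" using I(3) by (simp add: span_minimal)
  then have "T \<subseteq> span I" using torus_element_in_span_toral[OF T] by blast
  then have dimT: "dim T = card I" using I(1,2) by (intro dim_unique) auto
  have indI: "indep_family I (\<lambda>x. x)"
    using independent_imp_indep_family[of I "\<lambda>x. x"] finI I(2) by simp
  obtain c :: "'a \<Rightarrow> 'k" where c: "inj_on (\<lambda>J. \<Sum>i\<in>J. c i) (Pow I)"
    using exists_distinct_subset_sums[OF finI] by blast
  define t where "t = (\<Sum>i\<in>I. scale (c i) i)"
  have tT: "t \<in> T"
    unfolding t_def using torus_subspace[OF T] I(1) by (auto intro!: subspace_sum subspace_scale)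
  have it: "(sq ^^ j) t = (\<Sum>i\<in>I. scale (c i ^ 2 ^ j) i)" for j
  proof (induction j)
    case 0
    show ?case by (simp add: t_def)
  next
    case (Suc j)
    have "(sq ^^ Suc j) t = (\<Sum>i\<in>I. scale ((c i ^ 2 ^ j) ^ 2) (sq i))"
      using finI I(1) toral_commutes_with_torus[OF T]
      by (simp add: Suc) (intro sq_sum, auto)
    also have "\<dots> = (\<Sum>i\<in>I. scale (c i ^ 2 ^ Suc j) i)"
      using I(1) by (intro sum.cong) (auto simp: mult.commute simp flip: power_mult)
    finally show ?case .
  qed
  have "indep_family {..<dim T} (\<lambda>i. (sq ^^ i) t)"
    unfolding indep_family_def
  proof (intro allI impI)
    fix a assume "(\<Sum>j<dim T. scale (a j) ((sq ^^ j) t)) = 0"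
    then have "(\<Sum>i\<in>I. scale (\<Sum>j<dim T. a j * c i ^ 2 ^ j) i) = 0"
      unfolding it by (simp add: scale_sum_right scale_sum_left sum.swap[of _ I])
    then have ci: "(\<Sum>j<dim T. a j * c i ^ 2 ^ j) = 0" if "i \<in> I" for i
      using indep_familyD[OF indI, of "\<lambda>i. \<Sum>j<dim T. a j * c i ^ 2 ^ j"] that by simp
    define p where "p = (\<Sum>j<dim T. monom (a j) (2 ^ j))"
    have p: "poly p x = (\<Sum>j<dim T. a j * x ^ 2 ^ j)" for x
      by (simp add: p_def poly_sum poly_monom)
    have "poly p (\<Sum>i\<in>J. c i) = 0" if "J \<subseteq> I" for J
      using finite_subset[OF that finI] that
    proof (induction J)
      case empty
      then show ?case by (simp add: p zero_power)
    next
      case (insert i J)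
      then show ?case using ci
        by (simp add: p scalar_power_add distrib_left sum.distrib)
    qed
    then have roots: "(\<lambda>J. \<Sum>i\<in>J. c i) ` Pow I \<subseteq> {x. poly p x = 0}" by blast
    have "p = 0"
    proof (rule ccontr)
      assume "p \<noteq> 0"
      have "2 ^ dim T = card ((\<lambda>J. \<Sum>i\<in>J. c i) ` Pow I)"
        using finI by (simp add: card_image[OF c] card_Pow dimT)
      also have "\<dots> \<le> card {x. poly p x = 0}"
        using roots poly_roots_finite[OF \<open>p \<noteq> 0\<close>] by (intro card_mono) auto
      also have "\<dots> \<le> degree p" using \<open>p \<noteq> 0\<close> by (rule card_poly_roots_bound)
      finally have large: "2 ^ dim T \<le> degree p" .
      have "degree p < 2 ^ dim T"
        unfolding p_def
      proof (rule degree_sum_less)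
        fix j assume "j \<in> {..<dim T}"
        then have "(2 :: nat) ^ j < 2 ^ dim T" by simp
        then show "degree (monom (a j) (2 ^ j)) < 2 ^ dim T"
          using degree_monom_le[of "a j" "2 ^ j"] by linarith
      qed simp
      then show False using large by simp
    qed
    show "\<forall>j\<in>{..<dim T}. a j = 0"
    proof
      fix j assume j: "j \<in> {..<dim T}"
      have "coeff p (2 ^ j) = (\<Sum>i<dim T. if i = j then a i else 0)"
        unfolding p_def coeff_sum by (intro sum.cong) auto
      also have "\<dots> = a j" using j by simp
      finally show "a j = 0" using \<open>p = 0\<close> by simp
    qed
  qed
  with tT show ?thesis by (rule that)
qed

lemma polymap_bracket:
  assumes "polymap p" "polymap q"
  shows "polymap (\<lambda>l. bracket (p l) (q l))"
  using assms(1)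
proof (induction rule: polymap.induct)
  case (const v)
  show ?case using assms(2)
    by (induction rule: polymap.induct)
      (auto intro: polymap.intros simp: bracket_add_right bracket_scale_right)
qed (auto intro: polymap.intros simp: bracket_add_left bracket_scale_left)

lemma polymap_sq:
  assumes "polymap p"
  shows "polymap (\<lambda>l. sq (p l))"
  using assms
proof (induction rule: polymap.induct)
  case (scale_var p)
  have "polymap (\<lambda>l. scale l (scale l (sq (p l))))"
    using scale_var.IH by (intro polymap.scale_var)
  then show ?case by (simp add: sq_scale power2_eq_square)
qed (auto intro: polymap.intros polymap_bracket simp: sq_add)

text \<open>
  The iterates of \<open>x\<close> lie in the centralizer of \<open>x\<close>, so they are independent of any \<open>w \<alpha>\<close>
  whose brackets with \<open>x\<close> are independent. On the line through a generator \<open>t\<close> of the torus and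
  the given \<open>h\<close>, both families are independent for almost all points: the iterates because they
  are so at \<open>t\<close>, the brackets because they are so at \<open>h\<close>. This replaces the conjugacy of maximal
  tori, which fails for general restricted Lie algebras.
\<close>

lemma torus_dim_bound:
  assumes T: "torus T" and "finite R" and w: "indep_family R (\<lambda>\<alpha>. bracket h (w \<alpha>))"
  shows "dim T + card R \<le> dim UNIV"
proof -
  obtain t where t: "t \<in> T" "indep_family {..<dim T} (\<lambda>i. (sq ^^ i) t)"
    using torus_generator[OF T] by blast
  define x where "x l = t + scale l (h - t)" for l
  have x01: "x 0 = t" "x 1 = h" by (simp_all add: x_def)
  have x: "polymap x"
    unfolding x_def by (intro polymap.intros)
  have "polymap (\<lambda>l. (sq ^^ i) (x l))" for i
    by (induction i) (auto intro: x polymap_sq)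
  then have "finite {l. \<not> indep_family {..<dim T} (\<lambda>i. (sq ^^ i) (x l))}"
    using t(2) x01 indep_family_generic[of "{..<dim T}" "\<lambda>i l. (sq ^^ i) (x l)" 0] by simp
  moreover have "finite {l. \<not> indep_family R (\<lambda>\<alpha>. bracket (x l) (w \<alpha>))}"
    using w x01 x assms(2) indep_family_generic[of R "\<lambda>\<alpha> l. bracket (x l) (w \<alpha>)" 1]
    by (simp add: polymap_bracket polymap.const)
  ultimately obtain l where
    "l \<notin> {l. \<not> indep_family {..<dim T} (\<lambda>i. (sq ^^ i) (x l))} \<union>
      {l. \<not> indep_family R (\<lambda>\<alpha>. bracket (x l) (w \<alpha>))}"
    using infinite_UNIV_alg_closed by (metis ex_new_if_finite finite_UnI)
  then have i1: "indep_family {..<dim T} (\<lambda>i. (sq ^^ i) (x l))"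
    and i2: "indep_family R (\<lambda>\<alpha>. bracket (x l) (w \<alpha>))" by auto
  let ?I = "{..<dim T} <+> R"
  let ?u = "case_sum (\<lambda>i. (sq ^^ i) (x l)) w"
  have comm: "bracket (x l) ((sq ^^ i) (x l)) = 0" for i
    using iterates_commute[of 0 "x l" i] by simp
  have "indep_family ?I ?u"
    unfolding indep_family_def
  proof (intro allI impI)
    fix c assume "(\<Sum>i\<in>?I. scale (c i) (?u i)) = 0"
    then have s: "(\<Sum>i<dim T. scale (c (Inl i)) ((sq ^^ i) (x l))) + (\<Sum>\<alpha>\<in>R. scale (c (Inr \<alpha>)) (w \<alpha>)) = 0"
      using assms(2) by (simp add: sum.Plus)
    have "bracket (x l) ((\<Sum>i<dim T. scale (c (Inl i)) ((sq ^^ i) (x l))) + (\<Sum>\<alpha>\<in>R. scale (c (Inr \<alpha>)) (w \<alpha>)))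
        = (\<Sum>\<alpha>\<in>R. scale (c (Inr \<alpha>)) (bracket (x l) (w \<alpha>)))"
      by (simp add: bracket_add_right bracket_sum_right bracket_scale_right comm)
    then have R: "c (Inr \<alpha>) = 0" if "\<alpha> \<in> R" for \<alpha>
      using indep_familyD[OF i2, of "\<lambda>\<alpha>. c (Inr \<alpha>)" \<alpha>] that s by simp
    then have "(\<Sum>i<dim T. scale (c (Inl i)) ((sq ^^ i) (x l))) = 0" using s by simp
    then have "c (Inl i) = 0" if "i < dim T" for i
      using indep_familyD[OF i1, of "\<lambda>i. c (Inl i)" i] that by simp
    with R show "\<forall>i\<in>?I. c i = 0" by auto
  qed
  then have "card ?I \<le> dim UNIV"
    using assms(2) by (intro indep_family_card_le) auto
  then show ?thesis using assms(2) by (simp add: card_Plus)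
qed

text \<open>
  The elements of \<open>S\<close> are toral, since they act with eigenvalues \<open>0\<close> and \<open>1\<close> and the center is
  zero. A combination of them whose coefficients have distinct subset sums acts on every \<open>e \<alpha>\<close> by
  a nonzero scalar, so that the preceding bound applies with the \<open>e \<alpha>\<close> in the role of \<open>w\<close>.
\<close>

theorem toral_rank_eq_dim_split_torus:
  assumes center: "center = {0}" and fin: "finite S" "finite R"
    and comm: "\<And>s s'. s \<in> S \<Longrightarrow> s' \<in> S \<Longrightarrow> bracket s s' = 0"
    and weight: "\<And>s \<alpha>. s \<in> S \<Longrightarrow> \<alpha> \<in> R \<Longrightarrow> bracket s (e \<alpha>) = 0 \<or> bracket s (e \<alpha>) = e \<alpha>"
    and nonzero: "\<And>\<alpha>. \<alpha> \<in> R \<Longrightarrow> \<exists>s\<in>S. bracket s (e \<alpha>) \<noteq> 0"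
    and ind: "indep_family R e" and span: "span (S \<union> e ` R) = UNIV"
  shows "toral_rank = dim (span S)"
proof -
  let ?H = "span S"
  define \<chi> :: "_ \<Rightarrow> 'a \<Rightarrow> 'k" where "\<chi> \<alpha> s = (if bracket s (e \<alpha>) = 0 then 0 else 1)" for \<alpha> s
  have chi: "\<chi> \<alpha> s \<in> {0, 1}" for \<alpha> s by (simp add: \<chi>_def)
  have weight: "bracket s (e \<alpha>) = scale (\<chi> \<alpha> s) (e \<alpha>)" if "s \<in> S" "\<alpha> \<in> R" for s \<alpha>
    using weight[OF that] by (auto simp: \<chi>_def)
  have nonzero: "\<exists>s\<in>S. \<chi> \<alpha> s \<noteq> 0" if "\<alpha> \<in> R" for \<alpha>
    using nonzero[OF that] by (simp add: \<chi>_def)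
  have H_comm: "bracket x y = 0" if "x \<in> ?H" "y \<in> ?H" for x y
    using span_commutes[of S] comm that by blast
  have central: "x = 0" if "\<And>s. s \<in> S \<Longrightarrow> bracket x s = 0" "\<And>\<alpha>. \<alpha> \<in> R \<Longrightarrow> bracket x (e \<alpha>) = 0" for x
  proof -
    have "bracket x y = 0" for y
      using commutes_with_span[of "S \<union> e ` R" x y] that span by auto
    then show ?thesis using center by (auto simp: center_def)
  qed
  have weight': "bracket (\<Sum>s\<in>S. scale (c s) s) (e \<alpha>) = scale (\<Sum>s\<in>S. c s * \<chi> \<alpha> s) (e \<alpha>)"
    if "\<alpha> \<in> R" for c \<alpha>
    using that weight by (simp add: bracket_sum_left bracket_scale_left scale_sum_left)
  have sqS: "sq s = s" if s: "s \<in> S" for s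
  proof -
    have "sq s - s = 0"
    proof (rule central)
      fix s' assume "s' \<in> S"
      then show "bracket (sq s - s) s' = 0" using s comm by (simp add: bracket_diff_left ad_sq)
    next
      fix \<alpha> assume a: "\<alpha> \<in> R"
      then show "bracket (sq s - s) (e \<alpha>) = 0"
        using s chi[of \<alpha> s] by (auto simp: bracket_diff_left ad_sq weight bracket_scale_right)
    qed
    then show ?thesis by simp
  qed
  have sqH: "sq (\<Sum>s\<in>S. scale (c s) s) = (\<Sum>s\<in>S. scale (c s ^ 2) s)" for c
    using sq_sum[OF fin(1), of "\<lambda>s. s" c] comm sqS by simp
  have spanS: "\<exists>c. x = (\<Sum>s\<in>S. scale (c s) s)" if "x \<in> ?H" for x
    using that span_finite[OF fin(1)] by auto
  have inj: "inj_on sq ?H"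
  proof (rule inj_onI)
    fix x y assume xy: "x \<in> ?H" "y \<in> ?H" "sq x = sq y"
    then have H: "x + y \<in> ?H" by (simp add: span_add)
    have sq0: "sq (x + y) = 0" using xy H_comm by (simp add: sq_add add_self)
    obtain c where c: "x + y = (\<Sum>s\<in>S. scale (c s) s)" using spanS[OF H] by blast
    have "x + y = 0"
    proof (rule central)
      fix s assume "s \<in> S"
      then show "bracket (x + y) s = 0" using H_comm[OF H] span_base by blast
    next
      fix \<alpha> assume a: "\<alpha> \<in> R"
      have "bracket (x + y) (bracket (x + y) (e \<alpha>)) = 0" using sq0 ad_sq[of "x + y" "e \<alpha>"] by simp
      then show "bracket (x + y) (e \<alpha>) = 0"
        unfolding c using weight'[OF a, of c] by (auto simp: bracket_scale_right)
    qed
    then show "x = y" using minus_self[of y] by (simp add: eq_neg_iff_add_eq_0[symmetric])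
  qed
  have "sq ` ?H = ?H"
  proof
    show "sq ` ?H \<subseteq> ?H"
    proof
      fix y assume "y \<in> sq ` ?H"
      then obtain c where "y = sq (\<Sum>s\<in>S. scale (c s) s)" using spanS by blast
      then show "y \<in> ?H" by (simp add: sqH span_sum span_scale span_base)
    qed
    show "?H \<subseteq> sq ` ?H"
    proof
      fix x assume "x \<in> ?H"
      then obtain c where c: "x = (\<Sum>s\<in>S. scale (c s) s)" using spanS by blast
      obtain d where d: "\<And>s. d s ^ 2 = c s" using exists_scalar_sqrt[of c] by blast
      have "x = sq (\<Sum>s\<in>S. scale (d s) s)" by (simp add: sqH d c)
      moreover have "(\<Sum>s\<in>S. scale (d s) s) \<in> ?H" by (simp add: span_sum span_scale span_base)
      ultimately show "x \<in> sq ` ?H" by blast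
    qed
  qed
  then have torusH: "torus ?H"
    using inj H_comm span_zero by (auto simp: torus_def subalgebra_def bij_betw_def)
  obtain c :: "'a \<Rightarrow> 'k" where c: "inj_on (\<lambda>J. \<Sum>s\<in>J. c s) (Pow S)"
    using exists_distinct_subset_sums[OF fin(1)] by blast
  define h where "h = (\<Sum>s\<in>S. scale (c s) s)"
  have regular: "(\<Sum>s\<in>S. c s * \<chi> \<alpha> s) \<noteq> 0" if a: "\<alpha> \<in> R" for \<alpha>
  proof -
    let ?J = "{s \<in> S. \<chi> \<alpha> s \<noteq> 0}"
    have "(\<Sum>s\<in>S. c s * \<chi> \<alpha> s) = (\<Sum>s\<in>?J. c s)"
      using fin(1) chi[of \<alpha>] by (intro sum.mono_neutral_cong_right) auto
    moreover have "?J \<noteq> {}" using nonzero[OF a] by blast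
    then have "(\<Sum>s\<in>?J. c s) \<noteq> (\<Sum>s\<in>{}. c s)"
      using inj_onD[OF c, of ?J "{}"] by blast
    ultimately show ?thesis by simp
  qed
  have "indep_family R (\<lambda>\<alpha>. bracket h (e \<alpha>))"
    unfolding indep_family_def
  proof (intro allI impI)
    fix b assume "(\<Sum>\<alpha>\<in>R. scale (b \<alpha>) (bracket h (e \<alpha>))) = 0"
    then have "(\<Sum>\<alpha>\<in>R. scale (b \<alpha> * (\<Sum>s\<in>S. c s * \<chi> \<alpha> s)) (e \<alpha>)) = 0"
      by (simp add: h_def weight' cong: sum.cong)
    then have "b \<alpha> * (\<Sum>s\<in>S. c s * \<chi> \<alpha> s) = 0" if "\<alpha> \<in> R" for \<alpha>
      using indep_familyD[OF ind, of "\<lambda>\<alpha>. b \<alpha> * (\<Sum>s\<in>S. c s * \<chi> \<alpha> s)"] that by simp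
    then show "\<forall>\<alpha>\<in>R. b \<alpha> = 0" using regular by auto
  qed
  note bound = torus_dim_bound[OF _ fin(2) this]
  obtain C where C: "C \<subseteq> S" "independent C" "S \<subseteq> span C"
    using maximal_independent_subset by blast
  have spC: "span C = ?H" using C span_mono[OF C(1)] span_minimal[OF C(3)] by auto
  have finC: "finite C" using C(1) fin(1) finite_subset by blast
  have "UNIV \<subseteq> span (C \<union> e ` R)"
    using span_minimal[of "S \<union> e ` R" "span (C \<union> e ` R)"] span C(3)
      span_mono[of C "C \<union> e ` R"] span_superset[of "C \<union> e ` R"] by auto
  then have "dim UNIV \<le> card (C \<union> e ` R)"
    using finC fin(2) by (intro dim_le_card) auto
  also have "\<dots> \<le> card C + card R"
    using card_Un_le[of C "e ` R"] card_image_le[OF fin(2), of e] by linarith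
  also have "card C = dim ?H" using dim_span_eq_card_independent[OF C(2)] spC by simp
  finally have "dim T \<le> dim ?H" if "torus T" for T using bound[OF that] by simp
  then have "toral_rank = dim ?H"
    unfolding toral_rank_def using torusH
    by (intro Max_eqI) (auto intro: finite_subset[of _ "{..dim ?H}"] exI[of _ ?H])
  then show ?thesis .
qed

end

section \<open>Root decomposition with respect to a Chevalley basis\<close>

text \<open>
  What a Chevalley basis provides for every type of root system alike; \<open>S\<close> stands for
  the set of coroots of the simple roots.
\<close>

locale chevalley_lattice = lie_algebra scale bracket
  for scale :: "'k::field_char_0 \<Rightarrow> 'a::ab_group_add \<Rightarrow> 'a" and bracket +
  fixes H S :: "'a set" and e :: "('a \<Rightarrow> 'k) \<Rightarrow> 'a"
  assumes cartan: "cartan_subalgebra H"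
    and S_coroots: "S \<subseteq> (\<lambda>\<alpha>. bracket (e \<alpha>) (e (\<lambda>t. - \<alpha> t))) ` roots H"
    and indep_basis: "independent (S \<union> e ` roots H)"
    and span_basis: "span (S \<union> e ` roots H) = UNIV"
    and root_vector: "\<alpha> \<in> roots H \<Longrightarrow> e \<alpha> \<in> weight_space H \<alpha>"
    and coroot_in_H: "\<alpha> \<in> roots H \<Longrightarrow> bracket (e \<alpha>) (e (\<lambda>t. - \<alpha> t)) \<in> H"
    and root_coroot: "\<alpha> \<in> roots H \<Longrightarrow> \<alpha> (bracket (e \<alpha>) (e (\<lambda>t. - \<alpha> t))) = 2"
    and integral: "x \<in> S \<union> e ` roots H \<Longrightarrow> y \<in> S \<union> e ` roots H \<Longrightarrow>
      bracket x y \<in> int_span (S \<union> e ` roots H)"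
begin

abbreviation R where "R \<equiv> roots H"
abbreviation neg :: "('a \<Rightarrow> 'k) \<Rightarrow> 'a \<Rightarrow> 'k" where "neg \<alpha> \<equiv> (\<lambda>t. - \<alpha> t)"
definition B where "B = S \<union> e ` R"
definition coroot where "coroot \<alpha> = bracket (e \<alpha>) (e (neg \<alpha>))"

lemma indep_B: "independent B" and span_B: "span B = UNIV"
  using indep_basis span_basis by (auto simp: B_def)

lemma finite_B: "finite B"
  using independent_span_bound[OF _ indep_B] finite_dim by auto

lemma finite_S: "finite S"
  using finite_B by (simp add: B_def)

lemma coroot_H: "\<alpha> \<in> R \<Longrightarrow> coroot \<alpha> \<in> H"
  using coroot_in_H by (simp add: coroot_def)

lemma root_coroot_2: "\<alpha> \<in> R \<Longrightarrow> \<alpha> (coroot \<alpha>) = 2"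
  using root_coroot by (simp add: coroot_def)

lemma S_H: "S \<subseteq> H"
  using S_coroots coroot_in_H by auto

lemma subspace_H: "subspace H"
  using cartan by (simp add: cartan_subalgebra_def subalgebra_def)

lemma root_form: "\<alpha> \<in> R \<Longrightarrow> \<alpha> \<in> linear_forms H"
  by (simp add: roots_def)

lemma form_zero: "\<alpha> \<in> linear_forms H \<Longrightarrow> \<alpha> 0 = 0"
  using subspace_0[OF subspace_H] unfolding linear_forms_def by (metis (mono_tags, lifting) add_cancel_right_left mem_Collect_eq)

lemma form_eqI:
  assumes "\<alpha> \<in> linear_forms H" "\<beta> \<in> linear_forms H" "\<And>t. t \<in> H \<Longrightarrow> \<alpha> t = \<beta> t"
  shows "\<alpha> = \<beta>"
proof
  fix t show "\<alpha> t = \<beta> t" using assms by (cases "t \<in> H") (auto simp: linear_forms_def)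
qed

lemma neg_form: "\<alpha> \<in> linear_forms H \<Longrightarrow> neg \<alpha> \<in> linear_forms H"
  by (auto simp: linear_forms_def)

lemma add_form: "\<alpha> \<in> linear_forms H \<Longrightarrow> \<beta> \<in> linear_forms H \<Longrightarrow> (\<lambda>t. \<alpha> t + \<beta> t) \<in> linear_forms H"
  by (auto simp: linear_forms_def algebra_simps)

lemma form_sum:
  assumes "\<alpha> \<in> linear_forms H" "finite I" "\<And>i. i \<in> I \<Longrightarrow> f i \<in> H"
  shows "\<alpha> (\<Sum>i\<in>I. scale (c i) (f i)) = (\<Sum>i\<in>I. c i * \<alpha> (f i))"
  using assms(2,3)
proof (induction I)
  case empty
  then show ?case using form_zero[OF assms(1)] by simp
next
  case (insert i I)
  moreover have "(\<Sum>i\<in>I. scale (c i) (f i)) \<in> H" "scale (c i) (f i) \<in> H"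
    using insert.prems subspace_H by (auto intro!: subspace_sum subspace_scale)
  ultimately show ?case using assms(1) by (simp add: linear_forms_def)
qed

lemma bracket_H_root_vector: "t \<in> H \<Longrightarrow> \<alpha> \<in> R \<Longrightarrow> bracket t (e \<alpha>) = scale (\<alpha> t) (e \<alpha>)"
  using root_vector by (simp add: weight_space_def)

lemma B_nonzero: "b \<in> B \<Longrightarrow> b \<noteq> 0"
  using indep_B dependent_zero by blast

lemma root_vector_nonzero: "\<alpha> \<in> R \<Longrightarrow> e \<alpha> \<noteq> 0"
  using B_nonzero by (simp add: B_def)

lemma inj_on_e: "inj_on e R"
proof (rule inj_onI)
  fix \<alpha> \<beta> assume ab: "\<alpha> \<in> R" "\<beta> \<in> R" "e \<alpha> = e \<beta>"
  show "\<alpha> = \<beta>"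
  proof (rule form_eqI)
    fix t assume "t \<in> H"
    then have "scale (\<alpha> t) (e \<alpha>) = scale (\<beta> t) (e \<alpha>)"
      using ab bracket_H_root_vector[of t] by metis
    then show "\<alpha> t = \<beta> t" using root_vector_nonzero[OF ab(1)] by simp
  qed (use ab root_form in auto)
qed

lemma finite_R: "finite R"
  using finite_B finite_imageD[OF _ inj_on_e] by (simp add: B_def)

lemma cartan_ad_nilpotent:
  obtains n where "\<And>x y. x \<in> H \<Longrightarrow> y \<in> H \<Longrightarrow> (bracket x ^^ n) y = 0"
proof -
  have *: "(bracket x ^^ n) y \<in> lower_central H n" if "x \<in> H" "y \<in> H" for x y n
    by (induction n) (use that in \<open>auto intro!: span_base\<close>)
  obtain n where "lower_central H n = {0}"
    using cartan by (auto simp: cartan_subalgebra_def nilpotent_def)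
  with * show ?thesis by (intro that[of n]) blast
qed

lemma bracket_power_eigenvector: "bracket x y = scale c y \<Longrightarrow> (bracket x ^^ n) y = scale (c ^ n) y"
  by (induction n) (auto simp: bracket_scale_right mult.commute)

lemma no_eigenvector_in_H:
  assumes "x \<in> H" "y \<in> H" "bracket x y = scale c y" "c \<noteq> 0"
  shows "y = 0"
proof -
  obtain n where "\<And>x y. x \<in> H \<Longrightarrow> y \<in> H \<Longrightarrow> (bracket x ^^ n) y = 0"
    using cartan_ad_nilpotent by blast
  then show ?thesis using assms bracket_power_eigenvector[OF assms(3), of n] by simp
qed

lemma S_disjoint: "S \<inter> e ` R = {}"
proof (rule ccontr)
  assume "S \<inter> e ` R \<noteq> {}"
  then obtain \<alpha> where a: "\<alpha> \<in> R" "e \<alpha> \<in> H" using S_H by blast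
  then have "e \<alpha> = 0"
    using no_eigenvector_in_H[OF coroot_H[OF a(1)] a(2), of 2]
      bracket_H_root_vector[OF coroot_H[OF a(1)] a(1)] root_coroot_2[OF a(1)] by simp
  then show False using root_vector_nonzero a(1) by blast
qed

lemma sum_B: "(\<Sum>b\<in>B. f b) = (\<Sum>s\<in>S. f s) + (\<Sum>\<alpha>\<in>R. f (e \<alpha>))"
  using finite_B S_disjoint inj_on_e by (simp add: B_def sum.union_disjoint sum.reindex)

definition crd where "crd = representation B"

lemma crd_expand: "(\<Sum>b\<in>B. scale (crd x b) b) = x"
  unfolding crd_def by (rule sum_representation_eq) (auto simp: indep_B span_B finite_B)

lemma crd_add: "crd (x + y) b = crd x b + crd y b"
  using representation_add[OF indep_B] by (simp add: crd_def span_B)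

lemma crd_scale: "crd (scale c x) b = c * crd x b"
  using representation_scale[OF indep_B] by (simp add: crd_def span_B)

lemma crd_zero: "crd 0 b = 0"
  by (simp add: crd_def representation_zero)

lemma crd_sum: "crd (\<Sum>i\<in>I. f i) b = (\<Sum>i\<in>I. crd (f i) b)"
  by (subst representation_sum[OF indep_B, folded crd_def]) (auto simp: span_B crd_def)

lemma crd_basis: "b \<in> B \<Longrightarrow> crd b b' = (if b' = b then 1 else 0)"
  using representation_basis[OF indep_B] by (simp add: crd_def)

lemma crd_span:
  assumes "x \<in> span A" "A \<subseteq> B" "b \<notin> A"
  shows "crd x b = 0"
  using assms(1)
proof (induction rule: span_induct_alt)
  case base
  show ?case by (rule crd_zero)
next
  case (step c x y)
  then have "crd x b = 0" using assms(2,3) crd_basis[of x b] by (auto split: if_splits)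
  then show ?case using step by (simp add: crd_add crd_scale)
qed

lemma crd_eqI: "(\<And>b. b \<in> B \<Longrightarrow> crd x b = crd y b) \<Longrightarrow> x = y"
  using crd_expand[of x] crd_expand[of y] by (metis (no_types, lifting) sum.cong)

lemma crd_expand_split: "x = (\<Sum>s\<in>S. scale (crd x s) s) + (\<Sum>\<alpha>\<in>R. scale (crd x (e \<alpha>)) (e \<alpha>))"
  using crd_expand[of x] by (simp add: sum_B)

text \<open>
  On the part of an element of \<open>H\<close> in the span of the root vectors, \<open>H\<close> acts both nilpotently and
  diagonally, with nonzero eigenvalues at the coroots.
\<close>

lemma H_eq_span_S: "H = span S"
proof
  show "span S \<subseteq> H" using S_H subspace_H by (rule span_minimal)
  show "H \<subseteq> span S"
  proof
    fix x assume x: "x \<in> H"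
    define y where "y = (\<Sum>\<alpha>\<in>R. scale (crd x (e \<alpha>)) (e \<alpha>))"
    have s: "(\<Sum>s\<in>S. scale (crd x s) s) \<in> span S"
      by (intro span_sum span_scale span_base)
    then have "(\<Sum>s\<in>S. scale (crd x s) s) \<in> H" using \<open>span S \<subseteq> H\<close> by blast
    moreover have y_eq: "y = x - (\<Sum>s\<in>S. scale (crd x s) s)"
      using crd_expand_split[of x] by (simp add: y_def algebra_simps)
    ultimately have y: "y \<in> H" using x subspace_H by (simp add: subspace_diff)
    obtain n where n: "\<And>x y. x \<in> H \<Longrightarrow> y \<in> H \<Longrightarrow> (bracket x ^^ n) y = 0"
      using cartan_ad_nilpotent by blast
    have pow: "(bracket t ^^ m) y = (\<Sum>\<alpha>\<in>R. scale (\<alpha> t ^ m * crd x (e \<alpha>)) (e \<alpha>))" if "t \<in> H" for t m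
      by (induction m) (use that in \<open>auto simp: y_def bracket_sum_right bracket_scale_right
          bracket_H_root_vector mult_ac intro!: sum.cong\<close>)
    have crd0: "crd x (e \<alpha>) = 0" if a: "\<alpha> \<in> R" for \<alpha>
    proof -
      let ?t = "coroot \<alpha>"
      have "0 = crd (\<Sum>\<beta>\<in>R. scale (\<beta> ?t ^ n * crd x (e \<beta>)) (e \<beta>)) (e \<alpha>)"
        using pow[OF coroot_H[OF a], of n] n[OF coroot_H[OF a] y] crd_zero by simp
      also have "\<dots> = (\<Sum>\<beta>\<in>R. if \<beta> = \<alpha> then \<alpha> ?t ^ n * crd x (e \<alpha>) else 0)"
        unfolding crd_sum crd_scale
        using a inj_on_e by (intro sum.cong) (auto simp: crd_basis B_def dest: inj_onD)
      also have "\<dots> = 2 ^ n * crd x (e \<alpha>)" using a finite_R root_coroot_2 by simp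
      finally show ?thesis by simp
    qed
    then have "y = 0" by (simp add: y_def)
    then show "x \<in> span S" using s y_eq by simp
  qed
qed

lemma crd_H_root: "t \<in> H \<Longrightarrow> \<alpha> \<in> R \<Longrightarrow> crd t (e \<alpha>) = 0"
  by (rule crd_span[of t S]) (use H_eq_span_S S_disjoint B_def in blast)+

lemma crd_bracket_H:
  assumes t: "t \<in> H" and a: "\<alpha> \<in> R"
  shows "crd (bracket t x) (e \<alpha>) = \<alpha> t * crd x (e \<alpha>)"
proof -
  have "bracket t s \<in> H" if "s \<in> S" for s
    using cartan t that S_H by (auto simp: cartan_subalgebra_def subalgebra_def)
  then have s0: "crd (bracket t s) (e \<alpha>) = 0" if "s \<in> S" for s using crd_H_root a that by blast
  have "crd (bracket t x) (e \<alpha>) = (\<Sum>\<beta>\<in>R. crd x (e \<beta>) * (\<beta> t * crd (e \<beta>) (e \<alpha>)))"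
    by (subst crd_expand_split[of x])
      (simp add: bracket_add_right bracket_sum_right bracket_scale_right crd_add crd_sum crd_scale
        s0 bracket_H_root_vector[OF t] mult.assoc)
  also have "\<dots> = (\<Sum>\<beta>\<in>R. if \<beta> = \<alpha> then \<alpha> t * crd x (e \<alpha>) else 0)"
    using a inj_on_e by (intro sum.cong) (auto simp: crd_basis B_def dest: inj_onD)
  also have "\<dots> = \<alpha> t * crd x (e \<alpha>)" using a finite_R by simp
  finally show ?thesis .
qed

text \<open>
  What remains of a vector of weight \<open>\<alpha>\<close> after removing its component along \<open>e \<alpha>\<close> lies in \<open>H\<close>,
  where a nonzero eigenvalue contradicts nilpotency.
\<close>

lemma weight_space_root:
  assumes a: "\<alpha> \<in> R" and x: "x \<in> weight_space H \<alpha>"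
  shows "x = scale (crd x (e \<alpha>)) (e \<alpha>)"
proof -
  have other: "crd x (e \<beta>) = 0" if b: "\<beta> \<in> R" "\<beta> \<noteq> \<alpha>" for \<beta>
  proof -
    obtain t where t: "t \<in> H" "\<beta> t \<noteq> \<alpha> t" using form_eqI[of \<beta> \<alpha>] root_form a b by blast
    have "bracket t x = scale (\<alpha> t) x" using x t(1) by (simp add: weight_space_def)
    then have "\<beta> t * crd x (e \<beta>) = \<alpha> t * crd x (e \<beta>)"
      using crd_bracket_H[OF t(1) b(1), of x] crd_scale[of "\<alpha> t" x "e \<beta>"] by presburger
    then show ?thesis using t(2) by simp
  qed
  define y where "y = x - scale (crd x (e \<alpha>)) (e \<alpha>)"
  have "(\<Sum>\<beta>\<in>R. scale (crd x (e \<beta>)) (e \<beta>)) = (\<Sum>\<beta>\<in>{\<alpha>}. scale (crd x (e \<beta>)) (e \<beta>))"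
    using a finite_R other by (intro sum.mono_neutral_right) auto
  then have "y = (\<Sum>s\<in>S. scale (crd x s) s)"
    using crd_expand_split[of x] by (simp add: y_def algebra_simps)
  then have y: "y \<in> H" by (simp add: H_eq_span_S span_sum span_scale span_base)
  have "bracket (coroot \<alpha>) y = scale (\<alpha> (coroot \<alpha>)) y"
    using x coroot_H[OF a] bracket_H_root_vector[OF coroot_H[OF a] a]
    by (simp add: y_def weight_space_def bracket_diff_right bracket_scale_right
        scale_right_diff_distrib mult.commute)
  then have "y = 0"
    using no_eigenvector_in_H[OF coroot_H[OF a] y, of 2] root_coroot_2[OF a] by simp
  then show ?thesis by (simp add: y_def)
qed

lemma weight_space_bracket:
  assumes "x \<in> weight_space H \<alpha>" "y \<in> weight_space H \<beta>"
  shows "bracket x y \<in> weight_space H (\<lambda>t. \<alpha> t + \<beta> t)"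
  using assms
  by (auto simp: weight_space_def bracket_derivation[of _ x y] bracket_scale_left bracket_scale_right
      scale_left_distrib)

lemma weight_space_nonroot:
  "\<mu> \<in> linear_forms H \<Longrightarrow> \<mu> \<noteq> (\<lambda>_. 0) \<Longrightarrow> \<mu> \<notin> R \<Longrightarrow> x \<in> weight_space H \<mu> \<Longrightarrow> x = 0"
  by (auto simp: roots_def)

lemma bracket_nonopposite:
  assumes "\<alpha> \<in> R" "\<beta> \<in> R" "\<beta> \<noteq> neg \<alpha>"
  shows "bracket (e \<alpha>) (e \<beta>) \<in> span (e ` R)"
    and "(\<lambda>t. \<alpha> t + \<beta> t) \<notin> R \<Longrightarrow> bracket (e \<alpha>) (e \<beta>) = 0"
proof -
  let ?\<mu> = "\<lambda>t. \<alpha> t + \<beta> t"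
  have w: "bracket (e \<alpha>) (e \<beta>) \<in> weight_space H ?\<mu>"
    using weight_space_bracket root_vector assms by blast
  have "?\<mu> \<noteq> (\<lambda>_. 0)"
  proof
    assume "?\<mu> = (\<lambda>_. 0)"
    then have "\<alpha> t + \<beta> t = 0" for t by meson
    then have "\<beta> t = - \<alpha> t" for t by (simp add: eq_neg_iff_add_eq_0 add.commute)
    then show False using assms(3) by blast
  qed
  moreover have "?\<mu> \<in> linear_forms H" using add_form root_form assms by blast
  ultimately show *: "?\<mu> \<notin> R \<Longrightarrow> bracket (e \<alpha>) (e \<beta>) = 0" using weight_space_nonroot w by blast
  show "bracket (e \<alpha>) (e \<beta>) \<in> span (e ` R)"
  proof (cases "?\<mu> \<in> R")
    case True
    then have "scale c (e ?\<mu>) \<in> span (e ` R)" for c by (intro span_scale span_base) auto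
    then show ?thesis using weight_space_root[OF True w] by metis
  next
    case False
    then show ?thesis using * span_zero by simp
  qed
qed

text \<open>
  If \<open>-\<alpha>\<close> were not a root, the component of weight \<open>0\<close> of \<open>[e \<alpha>, y]\<close> would vanish for every
  \<open>y\<close>, whereas the coroot of \<open>\<alpha>\<close> is a nonzero element of \<open>H\<close> of this form.
\<close>

lemma neg_root:
  assumes a: "\<alpha> \<in> R"
  shows "neg \<alpha> \<in> R"
proof (rule ccontr)
  assume n: "neg \<alpha> \<notin> R"
  let ?E = "span (e ` R)"
  have "bracket (e \<alpha>) b \<in> ?E" if b: "b \<in> B" for b
  proof (cases "b \<in> S")
    case True
    then have "bracket (e \<alpha>) b = scale (- \<alpha> b) (e \<alpha>)"
      using bracket_H_root_vector[of b \<alpha>] a S_H bracket_anti[of "e \<alpha>" b] by auto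
    moreover have "e \<alpha> \<in> ?E" using a by (simp add: span_base)
    ultimately show ?thesis by (simp add: span_neg span_scale)
  next
    case False
    then obtain \<beta> where "\<beta> \<in> R" "b = e \<beta>" using b by (auto simp: B_def)
    then show ?thesis using bracket_nonopposite(1)[OF a] n by blast
  qed
  then have "bracket (e \<alpha>) (\<Sum>b\<in>B. scale (crd y b) b) \<in> ?E" for y
    unfolding bracket_sum_right bracket_scale_right by (intro span_sum span_scale) auto
  then have E: "coroot \<alpha> \<in> ?E" by (simp add: crd_expand coroot_def)
  have "coroot \<alpha> = 0"
  proof (rule crd_eqI)
    fix b assume "b \<in> B"
    then consider "b \<in> S" | \<beta> where "\<beta> \<in> R" "b = e \<beta>" by (auto simp: B_def)
    then show "crd (coroot \<alpha>) b = crd 0 b"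
    proof cases
      case 1
      then show ?thesis using crd_span[OF E, of b] S_disjoint by (auto simp: B_def crd_zero)
    next
      case 2
      then show ?thesis using crd_H_root[OF coroot_H[OF a]] by (simp add: crd_zero)
    qed
  qed
  then show False using root_coroot_2[OF a] form_zero[OF root_form[OF a]] by simp
qed

lemma root_nonzero: "\<alpha> \<in> R \<Longrightarrow> \<exists>t\<in>H. \<alpha> t \<noteq> 0"
  using root_coroot_2 coroot_H by force

lemma H_commutes: "t \<in> H \<Longrightarrow> t' \<in> H \<Longrightarrow> bracket t t' = 0"
proof -
  have "bracket t (coroot \<alpha>) = 0" if "t \<in> H" "\<alpha> \<in> R" for t \<alpha>
    using bracket_derivation[of t "e \<alpha>" "e (neg \<alpha>)"] bracket_H_root_vector[OF that]
      bracket_H_root_vector[OF that(1) neg_root[OF that(2)]]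
    by (simp add: coroot_def bracket_minus_right bracket_scale_left bracket_scale_right)
  then have "bracket t s = 0" if "t \<in> H" "s \<in> S" for t s
    using that S_coroots by (auto simp: coroot_def)
  then show "t \<in> H \<Longrightarrow> t' \<in> H \<Longrightarrow> bracket t t' = 0"
    using commutes_with_span[of S t t'] by (simp add: H_eq_span_S)
qed

section \<open>The Killing form\<close>

definition tr where "tr f = (\<Sum>b\<in>B. crd (f b) b)"

lemma tr_commute:
  assumes "Vector_Spaces.linear scale scale f" "Vector_Spaces.linear scale scale g"
  shows "tr (\<lambda>x. f (g x)) = tr (\<lambda>x. g (f x))"
proof -
  have *: "crd (f (g x)) b = (\<Sum>d\<in>B. crd (g x) d * crd (f d) b)"
    if "Vector_Spaces.linear scale scale f" for f g :: "'a \<Rightarrow> 'a" and x b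
  proof -
    interpret f: Vector_Spaces.linear scale scale f by fact
    have "f (g x) = (\<Sum>d\<in>B. scale (crd (g x) d) (f d))"
      by (subst crd_expand[of "g x", symmetric]) (simp add: f.sum f.scale)
    then show ?thesis by (simp add: crd_sum crd_scale)
  qed
  show ?thesis
    unfolding tr_def *[OF assms(1)] *[OF assms(2)] by (subst sum.swap) (simp add: mult.commute)
qed

definition killing where "killing x y = tr (\<lambda>z. bracket x (bracket y z))"

lemma killing_add_left: "killing (x + y) z = killing x z + killing y z"
  by (simp add: killing_def tr_def bracket_add_left crd_add sum.distrib)

lemma killing_scale_left: "killing (scale c x) y = c * killing x y"
  by (simp add: killing_def tr_def bracket_scale_left crd_scale sum_distrib_left)

lemma killing_scale_right: "killing x (scale c y) = c * killing x y"
  by (simp add: killing_def tr_def bracket_scale_left bracket_scale_right crd_scale sum_distrib_left)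

lemma killing_sum_left: "killing (\<Sum>i\<in>I. f i) y = (\<Sum>i\<in>I. killing (f i) y)"
proof (induction I rule: infinite_finite_induct)
  case empty
  show ?case using killing_scale_left[of 0 0 y] by simp
qed (use killing_scale_left[of 0 0 y] in \<open>auto simp: killing_add_left\<close>)

lemma killing_commute: "killing x y = killing y x"
  unfolding killing_def using tr_commute[OF bracket_linear bracket_linear] .

lemma killing_sum_right: "killing y (\<Sum>i\<in>I. f i) = (\<Sum>i\<in>I. killing y (f i))"
  using killing_sum_left[of f I y] by (simp add: killing_commute)

lemma killing_invariant: "killing (bracket x y) z = killing x (bracket y z)"
proof -
  have br: "bracket (bracket u v) w = bracket u (bracket v w) - bracket v (bracket u w)" for u v w
    using bracket_derivation[of u v w] by (simp add: algebra_simps)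
  have crd_diff: "crd (u - v) b = crd u b - crd v b" for u v b
    using crd_add[of "u - v" v b] by simp
  have "Vector_Spaces.linear scale scale (\<lambda>w. bracket x (bracket z w))"
    by unfold_locales (auto simp: bracket_add_right bracket_scale_right)
  then have "tr (\<lambda>w. bracket y (bracket x (bracket z w))) = tr (\<lambda>w. bracket x (bracket z (bracket y w)))"
    using tr_commute[OF bracket_linear[of y]] by blast
  then show ?thesis
    by (simp add: killing_def tr_def br bracket_diff_right crd_diff sum_subtractf)
qed

lemma killing_weight_spaces:
  assumes "x \<in> weight_space H \<alpha>" "y \<in> weight_space H \<beta>" "t \<in> H" "\<alpha> t + \<beta> t \<noteq> 0"
  shows "killing x y = 0"
proof -
  have "bracket x t = scale (- \<alpha> t) x"
    using assms(1,3) bracket_anti[of x t] by (simp add: weight_space_def)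
  moreover have "bracket t y = scale (\<beta> t) y" using assms by (simp add: weight_space_def)
  ultimately have "- \<alpha> t * killing x y = \<beta> t * killing x y"
    using killing_invariant[of x t y] by (metis killing_scale_left killing_scale_right)
  then have "(\<alpha> t + \<beta> t) * killing x y = 0" by (simp add: distrib_right neg_eq_iff_add_eq_0)
  then show ?thesis using assms(4) by simp
qed

lemma H_weight_zero: "t \<in> H \<Longrightarrow> t \<in> weight_space H (\<lambda>_. 0)"
  using H_commutes by (simp add: weight_space_def)

lemma killing_H_root_vector: "t \<in> H \<Longrightarrow> \<alpha> \<in> R \<Longrightarrow> killing t (e \<alpha>) = 0"
  using killing_weight_spaces[OF H_weight_zero root_vector] root_nonzero by fastforce

lemma killing_root_vectors:
  assumes "\<alpha> \<in> R" "\<beta> \<in> R" "\<beta> \<noteq> neg \<alpha>"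
  shows "killing (e \<alpha>) (e \<beta>) = 0"
proof -
  obtain t where "t \<in> H" "\<beta> t \<noteq> neg \<alpha> t"
    using form_eqI[of \<beta> "neg \<alpha>"] neg_form root_form assms by blast
  then show ?thesis
    using killing_weight_spaces[OF root_vector[OF assms(1)] root_vector[OF assms(2)]]
    by (simp add: eq_neg_iff_add_eq_0 add.commute)
qed

lemma killing_H:
  assumes "t \<in> H" "t' \<in> H"
  shows "killing t t' = (\<Sum>\<gamma>\<in>R. \<gamma> t * \<gamma> t')"
proof -
  have "bracket t' s = 0" if "s \<in> S" for s using H_commutes assms(2) S_H that by blast
  then show ?thesis
    unfolding killing_def tr_def sum_B
    by (simp add: crd_zero bracket_H_root_vector assms bracket_scale_right crd_scale crd_basis B_def
        mult.commute)
qed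

lemma killing_coroot:
  assumes "t \<in> H" "\<alpha> \<in> R"
  shows "killing t (coroot \<alpha>) = \<alpha> t * killing (e \<alpha>) (e (neg \<alpha>))"
  using killing_invariant[of t "e \<alpha>" "e (neg \<alpha>)"] bracket_H_root_vector[OF assms]
  by (simp add: coroot_def killing_scale_left)

section \<open>Integrality\<close>

abbreviation lattice where "lattice \<equiv> int_span B"

lemma int_spanI: "x = (\<Sum>b\<in>B. scale (of_int (n b)) b) \<Longrightarrow> x \<in> lattice"
  by (auto simp: int_span_def)

lemma int_span_add: "x \<in> lattice \<Longrightarrow> y \<in> lattice \<Longrightarrow> x + y \<in> lattice"
proof -
  assume "x \<in> lattice" "y \<in> lattice"
  then obtain m n where "x = (\<Sum>b\<in>B. scale (of_int (m b)) b)" "y = (\<Sum>b\<in>B. scale (of_int (n b)) b)"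
    by (auto simp: int_span_def)
  then show "x + y \<in> lattice"
    by (intro int_spanI[of _ "\<lambda>b. m b + n b"]) (simp add: scale_left_distrib sum.distrib)
qed

lemma int_span_scale: "x \<in> lattice \<Longrightarrow> scale (of_int c) x \<in> lattice"
proof -
  assume "x \<in> lattice"
  then obtain n where "x = (\<Sum>b\<in>B. scale (of_int (n b)) b)"
    by (auto simp: int_span_def)
  then show "scale (of_int c) x \<in> lattice"
    by (intro int_spanI[of _ "\<lambda>b. c * n b"]) (simp add: scale_sum_right)
qed

lemma int_span_base: "x \<in> B \<Longrightarrow> x \<in> lattice"
  using finite_B
  by (intro int_spanI[of _ "\<lambda>b. if b = x then 1 else 0"])
    (simp add: if_distrib[of of_int] if_distrib[of "\<lambda>c. scale c _"] cong: if_cong)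

lemma int_span_zero: "0 \<in> lattice"
  by (intro int_spanI[of _ "\<lambda>_. 0"]) simp

lemma int_span_sum: "(\<And>i. i \<in> I \<Longrightarrow> f i \<in> lattice) \<Longrightarrow> (\<Sum>i\<in>I. f i) \<in> lattice"
  by (induction I rule: infinite_finite_induct) (auto intro: int_span_add int_span_zero)

lemma int_span_bracket:
  assumes "x \<in> B" "y \<in> lattice"
  shows "bracket x y \<in> lattice"
proof -
  obtain n where y: "y = (\<Sum>b\<in>B. scale (of_int (n b)) b)" using assms by (auto simp: int_span_def)
  have "bracket x b \<in> lattice" if "b \<in> B" for b
    using integral[of x b] assms(1) that by (simp add: B_def)
  then show ?thesis
    by (auto simp: y bracket_sum_right bracket_scale_right intro!: int_span_sum int_span_scale)
qed

lemma crd_int: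
  assumes "x \<in> lattice"
  shows "crd x b \<in> \<int>"
proof -
  obtain n where "x = (\<Sum>b\<in>B. scale (of_int (n b)) b)" using assms by (auto simp: int_span_def)
  then have "crd x b = (\<Sum>d\<in>B. of_int (n d) * (if b = d then 1 else 0))"
    by (simp add: crd_sum crd_scale crd_basis)
  then show ?thesis by (auto intro!: Ints_sum)
qed

definition zcrd :: "'a \<Rightarrow> 'a \<Rightarrow> int" where "zcrd x b = (THE n. crd x b = of_int n)"

lemma crd_zcrd: "x \<in> lattice \<Longrightarrow> crd x b = of_int (zcrd x b)"
  using crd_int[of x b] by (auto simp: zcrd_def Ints_def)

lemma zcrd_expand: "x \<in> lattice \<Longrightarrow> (\<Sum>b\<in>B. scale (of_int (zcrd x b)) b) = x"
  using crd_expand[of x] by (simp add: crd_zcrd)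

lemma coroot_int: "\<alpha> \<in> R \<Longrightarrow> coroot \<alpha> \<in> lattice"
  using int_span_bracket[of "e \<alpha>" "e (neg \<alpha>)"] neg_root int_span_base by (simp add: coroot_def B_def)

definition zkilling :: "'a \<Rightarrow> 'a \<Rightarrow> int" where "zkilling x y = (THE n. killing x y = of_int n)"

lemma killing_zkilling:
  assumes "x \<in> B" "y \<in> B"
  shows "killing x y = of_int (zkilling x y)"
proof -
  have "killing x y \<in> \<int>"
    unfolding killing_def tr_def
    using assms by (intro Ints_sum crd_int int_span_bracket) (auto intro: int_span_base)
  then show ?thesis by (auto simp: zkilling_def Ints_def)
qed

definition cint :: "('a \<Rightarrow> 'k) \<Rightarrow> 'a \<Rightarrow> int" where "cint \<alpha> t = (THE n. \<alpha> t = of_int n)"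

lemma root_value_int:
  assumes "\<alpha> \<in> R" "t \<in> H" "t \<in> lattice"
  shows "\<alpha> t = of_int (cint \<alpha> t)"
proof -
  have "bracket (e \<alpha>) t \<in> lattice" using assms by (intro int_span_bracket) (auto simp: B_def)
  moreover have "bracket (e \<alpha>) t = scale (- \<alpha> t) (e \<alpha>)"
    using bracket_H_root_vector[OF assms(2,1)] bracket_anti[of "e \<alpha>" t] by simp
  ultimately have "crd (scale (- \<alpha> t) (e \<alpha>)) (e \<alpha>) \<in> \<int>" using crd_int by metis
  then have "- \<alpha> t \<in> \<int>" using assms(1) unfolding crd_scale by (simp add: crd_basis B_def)
  then have "\<alpha> t \<in> \<int>" using Ints_minus by fastforce
  then show ?thesis by (auto simp: cint_def Ints_def)
qed

abbreviation N where "N \<alpha> \<beta> \<equiv> cint \<alpha> (coroot \<beta>)"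

lemma root_coroot_int: "\<alpha> \<in> R \<Longrightarrow> \<beta> \<in> R \<Longrightarrow> \<alpha> (coroot \<beta>) = of_int (N \<alpha> \<beta>)"
  using root_value_int coroot_H coroot_int by blast

lemma N_self: "\<alpha> \<in> R \<Longrightarrow> N \<alpha> \<alpha> = 2"
  using root_coroot_int[of \<alpha> \<alpha>] root_coroot_2[of \<alpha>] by (metis of_int_eq_iff of_int_numeral)

text \<open>
  By \<open>killing_coroot\<close>, the coroot of \<open>\<alpha>\<close> is dual to \<open>k \<alpha>\<close> times \<open>\<alpha>\<close> under the Killing form;
  thus \<open>k \<alpha>\<close> is half its square length.
\<close>

definition k where "k \<alpha> = zkilling (e \<alpha>) (e (neg \<alpha>))"

lemma killing_opposite: "\<alpha> \<in> R \<Longrightarrow> killing (e \<alpha>) (e (neg \<alpha>)) = of_int (k \<alpha>)"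
  using killing_zkilling neg_root by (simp add: k_def B_def)

lemma killing_coroots:
  assumes "\<alpha> \<in> R" "\<beta> \<in> R"
  shows "(\<Sum>\<gamma>\<in>R. N \<gamma> \<beta> * N \<gamma> \<alpha>) = N \<alpha> \<beta> * k \<alpha>"
proof -
  have "of_int (\<Sum>\<gamma>\<in>R. N \<gamma> \<beta> * N \<gamma> \<alpha>) = killing (coroot \<beta>) (coroot \<alpha>)"
    using assms by (simp add: killing_H coroot_H root_coroot_int)
  also have "\<dots> = of_int (N \<alpha> \<beta> * k \<alpha>)"
    using assms by (simp add: killing_coroot coroot_H root_coroot_int killing_opposite)
  finally show ?thesis by (simp only: of_int_eq_iff)
qed

lemma N_symmetrized:
  assumes "\<alpha> \<in> R" "\<beta> \<in> R"
  shows "N \<alpha> \<beta> * k \<alpha> = N \<beta> \<alpha> * k \<beta>"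
  using killing_coroots[OF assms] killing_coroots[OF assms(2,1)] by (simp add: mult.commute)

lemma k_pos:
  assumes "\<alpha> \<in> R"
  shows "k \<alpha> > 0"
proof -
  have "0 < N \<alpha> \<alpha> * N \<alpha> \<alpha>" by (simp add: N_self[OF assms])
  also have "\<dots> \<le> (\<Sum>\<gamma>\<in>R. N \<gamma> \<alpha> * N \<gamma> \<alpha>)"
    using assms finite_R by (intro member_le_sum) auto
  also have "\<dots> = 2 * k \<alpha>" using killing_coroots[OF assms assms] by (simp add: N_self[OF assms])
  finally show ?thesis by simp
qed

text \<open>
  The Cauchy--Schwarz inequality for the coroots of \<open>\<alpha>\<close> and \<open>\<beta>\<close> gives
  \<open>N \<alpha> \<beta> * N \<beta> \<alpha> \<le> 4\<close>, with equality only for \<open>\<beta> = \<plusminus>\<alpha>\<close>. Two even Cartan integers have a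
  product divisible by \<open>4\<close>.
\<close>

lemma even_cartan_integers_orthogonal:
  assumes a: "\<alpha> \<in> R" and b: "\<beta> \<in> R" and ne: "\<beta> \<noteq> \<alpha>" "\<beta> \<noteq> neg \<alpha>"
    and even: "even (N \<alpha> \<beta>)" "even (N \<beta> \<alpha>)"
  shows "N \<alpha> \<beta> = 0" "N \<beta> \<alpha> = 0"
proof -
  define p q where "p = N \<alpha> \<beta>" and "q = N \<beta> \<alpha>"
  have sym: "p * k \<alpha> = q * k \<beta>" using N_symmetrized[OF a b] by (simp add: p_def q_def)
  \<comment> \<open>twice the component of the coroot of \<open>\<beta>\<close> orthogonal to that of \<open>\<alpha>\<close> has this square length\<close>
  have sq: "(\<Sum>\<gamma>\<in>R. (2 * N \<gamma> \<beta> - p * N \<gamma> \<alpha>)\<^sup>2) = 2 * k \<beta> * (4 - p * q)"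
  proof -
    have "(\<Sum>\<gamma>\<in>R. (2 * N \<gamma> \<beta> - p * N \<gamma> \<alpha>)\<^sup>2) =
        4 * (\<Sum>\<gamma>\<in>R. N \<gamma> \<beta> * N \<gamma> \<beta>) - 4 * p * (\<Sum>\<gamma>\<in>R. N \<gamma> \<beta> * N \<gamma> \<alpha>)
          + p\<^sup>2 * (\<Sum>\<gamma>\<in>R. N \<gamma> \<alpha> * N \<gamma> \<alpha>)"
      by (simp add: sum_distrib_left sum.distrib sum_subtractf power2_eq_square algebra_simps)
    also have "\<dots> = 8 * k \<beta> - 2 * p * (p * k \<alpha>)"
      using killing_coroots[OF b b] killing_coroots[OF a b] killing_coroots[OF a a]
      by (simp add: N_self a b p_def power2_eq_square)
    finally show ?thesis by (simp add: sym algebra_simps)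
  qed
  have "p * q = 0"
  proof (rule ccontr)
    assume nz: "p * q \<noteq> 0"
    have "0 \<le> 2 * k \<beta> * (4 - p * q)" unfolding sq[symmetric] by (intro sum_nonneg) simp
    then have "p * q \<le> 4" using k_pos[OF b] by (simp add: zero_le_mult_iff)
    have "0 \<le> p * q"
    proof -
      have "0 \<le> (q * k \<beta>) * (q * k \<beta>)" by simp
      also have "\<dots> = (p * q) * (k \<alpha> * k \<beta>)" using sym by (metis mult.assoc mult.commute)
      finally show ?thesis
        using mult_pos_pos[OF k_pos[OF a] k_pos[OF b]] by (simp only: zero_le_mult_iff) linarith
    qed
    have "4 dvd p * q"
      using mult_dvd_mono[of 2 p 2 q] even by (simp add: p_def q_def)
    then obtain j where j: "p * q = 4 * j" by (rule dvdE)
    have "j = 1" using nz j \<open>p * q \<le> 4\<close> \<open>0 \<le> p * q\<close> by linarith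
    then have pq: "p * q = 4" using j by simp
    obtain u v where uv: "p = 2 * u" "q = 2 * v" using even by (auto simp: p_def q_def elim!: evenE)
    then have "u * v = 1" using pq by simp
    then have "u = v" "u * u = 1" by (auto simp: zmult_eq_1_iff)
    then have keq: "k \<alpha> = k \<beta>" using sym uv by (auto simp: zmult_eq_1_iff)
    have "(\<Sum>\<gamma>\<in>R. (2 * N \<gamma> \<beta> - p * N \<gamma> \<alpha>)\<^sup>2) = 0" using sq pq by simp
    then have "(2 * N \<gamma> \<beta> - p * N \<gamma> \<alpha>)\<^sup>2 = 0" if "\<gamma> \<in> R" for \<gamma>
      using finite_R that by (simp add: sum_nonneg_eq_0_iff)
    then have N: "N \<gamma> \<beta> = u * N \<gamma> \<alpha>" if "\<gamma> \<in> R" for \<gamma> using uv that by auto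
    have "\<beta> t = of_int u * \<alpha> t" if t: "t \<in> H" for t
    proof -
      have "\<beta> t * of_int (k \<beta>) = (\<Sum>\<gamma>\<in>R. \<gamma> t * of_int (N \<gamma> \<beta>))"
        using killing_coroot[OF t b] killing_H[OF t coroot_H[OF b]] by (simp add: killing_opposite b root_coroot_int)
      also have "\<dots> = of_int u * (\<Sum>\<gamma>\<in>R. \<gamma> t * of_int (N \<gamma> \<alpha>))"
        by (simp add: N sum_distrib_left mult_ac)
      also have "(\<Sum>\<gamma>\<in>R. \<gamma> t * of_int (N \<gamma> \<alpha>)) = \<alpha> t * of_int (k \<alpha>)"
        using killing_coroot[OF t a] killing_H[OF t coroot_H[OF a]] by (simp add: killing_opposite a root_coroot_int)
      finally show ?thesis using keq k_pos[OF b] by simp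
    qed
    moreover have "u = 1 \<or> u = - 1" using \<open>u * v = 1\<close> by (auto simp: zmult_eq_1_iff)
    ultimately have "(\<forall>t\<in>H. \<beta> t = \<alpha> t) \<or> (\<forall>t\<in>H. \<beta> t = neg \<alpha> t)" by auto
    then show False
      using ne form_eqI[of \<beta> \<alpha>] form_eqI[of \<beta> "neg \<alpha>"] neg_form root_form a b by blast
  qed
  then have "p = 0 \<and> q = 0"
    using sym k_pos[OF a] k_pos[OF b] by auto
  then show "N \<alpha> \<beta> = 0" "N \<beta> \<alpha> = 0" by (simp_all add: p_def q_def)
qed

end

section \<open>Reduction modulo 2\<close>

text \<open>
  \<open>\<iota>\<close> carries the lattice of the Chevalley basis to the Chevalley algebra over a field in which
  \<open>2 = 0\<close>, and \<open>\<pi>\<close> is the projection to its quotient by the center, which is simple.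
\<close>

locale chevalley_reduction =
  L: chevalley_lattice scaleL bracketL H S e + G: lie_algebra scaleG bracketG +
  Q: lie_algebra scale bracket
  for scaleL :: "'f::field_char_0 \<Rightarrow> 'l::ab_group_add \<Rightarrow> 'l" and bracketL H S e
    and scaleG :: "'k::field \<Rightarrow> 'c::ab_group_add \<Rightarrow> 'c" and bracketG
    and scale :: "'k \<Rightarrow> 'a::ab_group_add \<Rightarrow> 'a" and bracket +
  fixes \<iota> :: "'l \<Rightarrow> 'c" and \<pi> :: "'c \<Rightarrow> 'a"
  assumes char_2: "(2 :: 'k) = 0"
    and \<iota>_add: "x \<in> L.lattice \<Longrightarrow> y \<in> L.lattice \<Longrightarrow> \<iota> (x + y) = \<iota> x + \<iota> y"
    and \<iota>_bracket: "x \<in> L.lattice \<Longrightarrow> y \<in> L.lattice \<Longrightarrow> \<iota> (bracketL x y) = bracketG (\<iota> x) (\<iota> y)"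
    and \<iota>_inj: "inj_on \<iota> L.B"
    and \<iota>_indep: "G.independent (\<iota> ` L.B)" and \<iota>_span: "G.span (\<iota> ` L.B) = UNIV"
    and \<pi>_linear: "Vector_Spaces.linear scaleG scale \<pi>"
    and \<pi>_bracket: "\<pi> (bracketG v w) = bracket (\<pi> v) (\<pi> w)"
    and \<pi>_surj: "surj \<pi>" and \<pi>_kernel: "{v. \<pi> v = 0} = G.center"
    and Q_simple: "Q.simple"
begin

sublocale \<pi>: Vector_Spaces.linear scaleG scale \<pi>
  by (rule \<pi>_linear)

lemma of_int_mod_2: "of_int c = (if even c then 0 else (1 :: 'k))"
proof -
  have "of_int c = (of_int (2 * (c div 2) + c mod 2) :: 'k)" by simp
  also have "\<dots> = of_int (c mod 2)" unfolding of_int_add of_int_mult using char_2 by simp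
  finally show ?thesis by (simp add: even_iff_mod_2_eq_zero odd_iff_mod_2_eq_one)
qed

lemma even_int_combination: "(\<And>i. i \<in> I \<Longrightarrow> even (f i)) \<Longrightarrow> even (\<Sum>i\<in>I. f i :: int)"
  by (rule dvd_sum) auto

lemma \<iota>_zero: "\<iota> 0 = 0"
  using \<iota>_add[OF L.int_span_zero L.int_span_zero] by simp

lemma \<iota>_sum: "(\<And>i. i \<in> I \<Longrightarrow> f i \<in> L.lattice) \<Longrightarrow> \<iota> (\<Sum>i\<in>I. f i) = (\<Sum>i\<in>I. \<iota> (f i))"
  by (induction I rule: infinite_finite_induct) (auto simp: \<iota>_zero \<iota>_add L.int_span_sum)

lemma \<iota>_scale:
  assumes x: "x \<in> L.lattice"
  shows "\<iota> (scaleL (of_int c) x) = scaleG (of_int c) (\<iota> x)"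
proof (induction c rule: int_induct[where k = 0])
  case base
  show ?case by (simp add: \<iota>_zero)
next
  case (step1 i)
  have "\<iota> (scaleL (of_int (i + 1)) x) = \<iota> (scaleL (of_int i) x + x)"
    by (simp add: L.scale_left_distrib)
  also have "\<dots> = scaleG (of_int (i + 1)) (\<iota> x)"
    using step1 x by (simp add: \<iota>_add L.int_span_scale G.scale_left_distrib)
  finally show ?case .
next
  case (step2 i)
  have "\<iota> (scaleL (of_int i) x) = \<iota> (scaleL (of_int (i - 1)) x + x)"
    by (simp add: L.scale_left_diff_distrib)
  also have "\<dots> = \<iota> (scaleL (of_int (i - 1)) x) + \<iota> x"
    using x by (intro \<iota>_add L.int_span_scale)
  finally have "\<iota> (scaleL (of_int (i - 1)) x) = \<iota> (scaleL (of_int i) x) - \<iota> x" by simp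
  then show ?case using step2 by (simp add: G.scale_left_diff_distrib)
qed

lemma \<iota>_expand:
  assumes "x \<in> L.lattice"
  shows "\<iota> x = (\<Sum>b\<in>L.B. scaleG (of_int (L.zcrd x b)) (\<iota> b))"
proof -
  have "\<iota> x = \<iota> (\<Sum>b\<in>L.B. scaleL (of_int (L.zcrd x b)) b)"
    using L.zcrd_expand[OF assms] by simp
  also have "\<dots> = (\<Sum>b\<in>L.B. scaleG (of_int (L.zcrd x b)) (\<iota> b))"
    by (simp add: \<iota>_sum \<iota>_scale L.int_span_scale L.int_span_base)
  finally show ?thesis .
qed

definition gcrd where "gcrd v b = G.representation (\<iota> ` L.B) v (\<iota> b)"

lemma gcrd_add: "gcrd (v + w) b = gcrd v b + gcrd w b"
  using G.representation_add[OF \<iota>_indep] by (simp add: gcrd_def \<iota>_span)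

lemma gcrd_scale: "gcrd (scaleG c v) b = c * gcrd v b"
  using G.representation_scale[OF \<iota>_indep] by (simp add: gcrd_def \<iota>_span)

lemma gcrd_zero: "gcrd 0 b = 0"
  using gcrd_scale[of 0 0 b] by simp

lemma gcrd_minus: "gcrd (- v) b = - gcrd v b"
  using gcrd_scale[of "- 1" v b] by simp

lemma gcrd_sum: "gcrd (\<Sum>i\<in>I. f i) b = (\<Sum>i\<in>I. gcrd (f i) b)"
  by (induction I rule: infinite_finite_induct) (auto simp: gcrd_add gcrd_zero)

lemma gcrd_basis: "b \<in> L.B \<Longrightarrow> b' \<in> L.B \<Longrightarrow> gcrd (\<iota> b) b' = (if b' = b then 1 else 0)"
  using G.representation_basis[OF \<iota>_indep] \<iota>_inj by (auto simp: gcrd_def dest: inj_onD)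

lemma gcrd_expand: "(\<Sum>b\<in>L.B. scaleG (gcrd v b) (\<iota> b)) = v"
proof -
  have "(\<Sum>x\<in>\<iota> ` L.B. scaleG (G.representation (\<iota> ` L.B) v x) x) = v"
    by (rule G.sum_representation_eq) (auto simp: \<iota>_indep \<iota>_span L.finite_B)
  then show ?thesis by (simp add: sum.reindex[OF \<iota>_inj] gcrd_def)
qed

lemma gcrd_\<iota>: "x \<in> L.lattice \<Longrightarrow> b \<in> L.B \<Longrightarrow> gcrd (\<iota> x) b = of_int (L.zcrd x b)"
  using L.finite_B by (simp add: \<iota>_expand gcrd_sum gcrd_scale gcrd_basis if_distrib cong: if_cong)

lemma B_lattice: "s \<in> S \<Longrightarrow> s \<in> L.lattice" "\<alpha> \<in> L.R \<Longrightarrow> e \<alpha> \<in> L.lattice"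
  using L.int_span_base by (auto simp: L.B_def)

lemma B_cases:
  assumes "b \<in> L.B"
  obtains "b \<in> S" | \<alpha> where "\<alpha> \<in> L.R" "b = e \<alpha>"
  using assms by (auto simp: L.B_def)

lemma bracket_\<iota>_H_root:
  assumes "t \<in> H" "t \<in> L.lattice" "\<alpha> \<in> L.R"
  shows "bracketG (\<iota> t) (\<iota> (e \<alpha>)) = scaleG (of_int (L.cint \<alpha> t)) (\<iota> (e \<alpha>))"
  using assms L.bracket_H_root_vector[OF assms(1,3)] L.root_value_int[OF assms(3,1,2)]
    \<iota>_bracket[OF assms(2) B_lattice(2)[OF assms(3)]] \<iota>_scale[OF B_lattice(2)[OF assms(3)]]
  by simp

lemma bracket_\<iota>_H_S:
  assumes "t \<in> H" "t \<in> L.lattice" "s \<in> S"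
  shows "bracketG (\<iota> t) (\<iota> s) = 0"
  using \<iota>_bracket[OF assms(2) B_lattice(1)[OF assms(3)]] L.H_commutes[OF assms(1), of s] assms(3) L.S_H
    \<iota>_zero by auto

lemma gcrd_bracket_\<iota>_H:
  assumes t: "t \<in> H" "t \<in> L.lattice" and a: "\<alpha> \<in> L.R"
  shows "gcrd (bracketG (\<iota> t) v) (e \<alpha>) = of_int (L.cint \<alpha> t) * gcrd v (e \<alpha>)"
proof -
  have "gcrd (bracketG (\<iota> t) (\<iota> b)) (e \<alpha>) = (if b = e \<alpha> then of_int (L.cint \<alpha> t) else 0)"
    if "b \<in> L.B" for b
    using that
  proof (cases rule: B_cases)
    case 1
    then show ?thesis using bracket_\<iota>_H_S[OF t] L.S_disjoint a by (auto simp: gcrd_zero)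
  next
    case (2 \<beta>)
    then show ?thesis using bracket_\<iota>_H_root[OF t] a
      by (auto simp: gcrd_scale gcrd_basis L.B_def dest: inj_onD[OF L.inj_on_e])
  qed
  then have "gcrd (bracketG (\<iota> t) (\<Sum>b\<in>L.B. scaleG (gcrd v b) (\<iota> b))) (e \<alpha>)
      = (\<Sum>b\<in>L.B. gcrd v b * (if b = e \<alpha> then of_int (L.cint \<alpha> t) else 0))"
    by (simp add: G.bracket_sum_right G.bracket_scale_right gcrd_sum gcrd_scale)
  also have "\<dots> = of_int (L.cint \<alpha> t) * gcrd v (e \<alpha>)"
    using a L.finite_B by (simp add: L.B_def if_distrib mult.commute cong: if_cong)
  finally show ?thesis by (simp add: gcrd_expand)
qed

lemma gcrd_bracket_nonopposite:
  assumes "\<alpha> \<in> L.R" "\<beta> \<in> L.R" "\<beta> \<noteq> L.neg \<alpha>" "s \<in> S"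
  shows "gcrd (bracketG (\<iota> (e \<alpha>)) (\<iota> (e \<beta>))) s = 0"
proof -
  have "L.crd (bracketL (e \<alpha>) (e \<beta>)) s = 0"
    using L.crd_span[OF L.bracket_nonopposite(1)[OF assms(1-3)], of s] assms(4) L.S_disjoint
    by (auto simp: L.B_def)
  moreover have "bracketL (e \<alpha>) (e \<beta>) \<in> L.lattice"
    using assms by (intro L.int_span_bracket B_lattice) (auto simp: L.B_def)
  ultimately have "of_int (L.zcrd (bracketL (e \<alpha>) (e \<beta>)) s) = (0 :: 'f)"
    using L.crd_zcrd by metis
  then have "L.zcrd (bracketL (e \<alpha>) (e \<beta>)) s = 0" by simp
  moreover have "s \<in> L.B" using assms(4) by (simp add: L.B_def)
  ultimately show ?thesis
    using gcrd_\<iota>[OF \<open>bracketL (e \<alpha>) (e \<beta>) \<in> L.lattice\<close>] assms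
    by (simp add: \<iota>_bracket[symmetric] B_lattice)
qed

lemma coroot_combination:
  assumes "\<alpha> \<in> L.R" "\<beta> \<in> L.R"
  shows "L.N \<alpha> \<beta> = (\<Sum>s\<in>S. L.zcrd (L.coroot \<beta>) s * L.cint \<alpha> s)"
proof -
  note ct = L.coroot_int[OF assms(2)] L.coroot_H[OF assms(2)]
  have "L.coroot \<beta> = (\<Sum>s\<in>S. scaleL (of_int (L.zcrd (L.coroot \<beta>) s)) s)"
    using L.crd_expand_split[of "L.coroot \<beta>"] L.crd_H_root[OF ct(2)] L.crd_zcrd[OF ct(1)] by simp
  then have "of_int (L.N \<alpha> \<beta>) = \<alpha> (\<Sum>s\<in>S. scaleL (of_int (L.zcrd (L.coroot \<beta>) s)) s)"
    using L.root_coroot_int[OF assms] by simp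
  also have "\<dots> = (\<Sum>s\<in>S. of_int (L.zcrd (L.coroot \<beta>) s) * \<alpha> s)"
    by (rule L.form_sum[OF L.root_form[OF assms(1)] L.finite_S]) (use L.S_H in auto)
  also have "\<dots> = of_int (\<Sum>s\<in>S. L.zcrd (L.coroot \<beta>) s * L.cint \<alpha> s)"
    using L.root_value_int[OF assms(1)] L.S_H B_lattice(1) by (auto intro!: sum.cong)
  finally show ?thesis by (simp only: of_int_eq_iff)
qed

text \<open>
  Let a central \<open>z\<close> have a nonzero component in the direction of \<open>\<alpha>\<close>. As \<open>z\<close> commutes with \<open>H\<close>,
  the root \<open>\<alpha>\<close> is even on all basis coroots; as it commutes with the root vector of \<open>-\<alpha>\<close>, the
  coroot of \<open>\<alpha>\<close> is twice an integral combination of basis coroots. Together these make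
  \<open>2 = \<alpha> (coroot \<alpha>)\<close> divisible by \<open>4\<close>.
\<close>

lemma center_root_component:
  assumes z: "z \<in> G.center" and a: "\<alpha> \<in> L.R"
  shows "gcrd z (e \<alpha>) = 0"
proof (rule ccontr)
  assume nz: "gcrd z (e \<alpha>) \<noteq> 0"
  have comm: "bracketG v z = 0" for v
    using z G.bracket_anti[of v z] by (simp add: G.center_def)
  have ev1: "even (L.cint \<alpha> s)" if s: "s \<in> S" for s
  proof -
    have "s \<in> H" using s L.S_H by blast
    from gcrd_bracket_\<iota>_H[OF this B_lattice(1)[OF s] a, of z] nz
    show ?thesis by (simp add: comm gcrd_zero of_int_mod_2 split: if_splits)
  qed
  note na = L.neg_root[OF a]
  have ev2: "even (L.zcrd (L.coroot \<alpha>) s)" if s: "s \<in> S" for s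
  proof -
    have sB: "s \<in> L.B" using s by (simp add: L.B_def)
    have coeff: "gcrd (bracketG (\<iota> (e (L.neg \<alpha>))) (\<iota> b)) s =
        (if b = e \<alpha> then - of_int (L.zcrd (L.coroot \<alpha>) s) else 0)" if "b \<in> L.B" for b
      using that
    proof (cases rule: B_cases)
      case 1
      then have "b \<in> H" using L.S_H by blast
      then have "bracketG (\<iota> (e (L.neg \<alpha>))) (\<iota> b) = - scaleG (of_int (L.cint (L.neg \<alpha>) b)) (\<iota> (e (L.neg \<alpha>)))"
        using bracket_\<iota>_H_root[OF _ B_lattice(1)[OF 1] na] G.bracket_anti[of "\<iota> (e (L.neg \<alpha>))" "\<iota> b"] by simp
      then show ?thesis
        using s 1 a na L.S_disjoint sB
        by (auto simp: gcrd_minus gcrd_scale gcrd_basis L.B_def)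
    next
      case (2 \<beta>)
      show ?thesis
      proof (cases "\<beta> = \<alpha>")
        case True
        have "bracketG (\<iota> (e (L.neg \<alpha>))) (\<iota> (e \<alpha>)) = - \<iota> (L.coroot \<alpha>)"
          using G.bracket_anti[of "\<iota> (e (L.neg \<alpha>))" "\<iota> (e \<alpha>)"]
            \<iota>_bracket[OF B_lattice(2)[OF a] B_lattice(2)[OF na]]
          by (simp add: L.coroot_def)
        then show ?thesis using True 2 gcrd_\<iota>[OF L.coroot_int[OF a] sB] by (simp add: gcrd_minus)
      next
        case False
        then have "gcrd (bracketG (\<iota> (e (L.neg \<alpha>))) (\<iota> (e \<beta>))) s = 0"
          using gcrd_bracket_nonopposite[OF na 2(1) _ s] by simp
        moreover have "e \<beta> \<noteq> e \<alpha>" using False 2(1) a L.inj_on_e by (auto dest: inj_onD)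
        ultimately show ?thesis using 2 by simp
      qed
    qed
    have "0 = gcrd (bracketG (\<iota> (e (L.neg \<alpha>))) (\<Sum>b\<in>L.B. scaleG (gcrd z b) (\<iota> b))) s"
      by (simp add: gcrd_expand comm gcrd_zero)
    also have "\<dots> = (\<Sum>b\<in>L.B. gcrd z b * (if b = e \<alpha> then - of_int (L.zcrd (L.coroot \<alpha>) s) else 0))"
      by (simp add: G.bracket_sum_right G.bracket_scale_right gcrd_sum gcrd_scale coeff)
    also have "\<dots> = (\<Sum>b\<in>{e \<alpha>}. gcrd z b * (if b = e \<alpha> then - of_int (L.zcrd (L.coroot \<alpha>) s) else 0))"
      using a L.finite_B by (intro sum.mono_neutral_right) (auto simp: L.B_def)
    finally show ?thesis using nz by (simp add: of_int_mod_2 split: if_splits)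
  qed
  have "4 dvd (\<Sum>s\<in>S. L.zcrd (L.coroot \<alpha>) s * L.cint \<alpha> s)"
    using mult_dvd_mono[OF ev2 ev1] by (intro dvd_sum) auto
  then show False using coroot_combination[OF a a] L.N_self[OF a] by simp
qed

lemma center_subset_span_S:
  assumes "z \<in> G.center"
  shows "z \<in> G.span (\<iota> ` S)"
proof -
  have "z = (\<Sum>s\<in>S. scaleG (gcrd z s) (\<iota> s)) + (\<Sum>\<alpha>\<in>L.R. scaleG (gcrd z (e \<alpha>)) (\<iota> (e \<alpha>)))"
    using gcrd_expand[of z] by (simp add: L.sum_B)
  then have "z = (\<Sum>s\<in>S. scaleG (gcrd z s) (\<iota> s))"
    using center_root_component[OF assms] by simp
  moreover have "(\<Sum>s\<in>S. scaleG (gcrd z s) (\<iota> s)) \<in> G.span (\<iota> ` S)"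
    by (intro G.span_sum G.span_scale G.span_base) simp
  ultimately show ?thesis by simp
qed

lemma bracketG_eqI:
  assumes "\<And>b. b \<in> L.B \<Longrightarrow> \<pi> (bracketG v (\<iota> b)) = 0"
  shows "\<pi> (bracketG v w) = 0"
  by (subst gcrd_expand[of w, symmetric])
    (simp add: G.bracket_sum_right G.bracket_scale_right \<pi>.sum \<pi>.scale assms)

lemma \<pi>_zero_iff: "\<pi> v = 0 \<longleftrightarrow> v \<in> G.center"
  using \<pi>_kernel by auto

lemma Q_center: "Q.center = {0}"
proof -
  have "Q.lie_ideal Q.center"
    unfolding Q.lie_ideal_def Q.center_def Q.subspace_def
    by (auto simp: Q.bracket_add_left Q.bracket_scale_left Q.bracket_anti[of _ "bracket _ _"]) (metis Q.bracket_anti Q.bracket_zero_left neg_equal_0_iff_equal)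
  moreover have "Q.center \<noteq> UNIV"
    using Q_simple by (auto simp: Q.simple_def Q.center_def)
  ultimately show ?thesis using Q_simple by (auto simp: Q.simple_def)
qed

lemma ideal_dichotomy:
  assumes "G.lie_ideal I" "\<not> I \<subseteq> G.center"
  shows "\<exists>w\<in>I. v - w \<in> G.center"
proof -
  have "Q.lie_ideal (\<pi> ` I)"
    unfolding Q.lie_ideal_def
  proof (intro conjI allI ballI)
    show "Q.subspace (\<pi> ` I)"
      using assms(1) \<pi>.subspace_image by (simp add: G.lie_ideal_def)
    fix x y assume "y \<in> \<pi> ` I"
    then obtain w where w: "w \<in> I" "y = \<pi> w" by blast
    obtain u where u: "x = \<pi> u" using \<pi>_surj by blast
    have "bracket x y = \<pi> (bracketG u w)" by (simp add: u w \<pi>_bracket)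
    then show "bracket x y \<in> \<pi> ` I" using assms(1) w(1) by (auto simp: G.lie_ideal_def)
  qed
  moreover have "\<pi> ` I \<noteq> {0}" using assms(2) \<pi>_zero_iff by blast
  ultimately have "\<pi> ` I = UNIV" using Q_simple by (auto simp: Q.simple_def)
  then obtain w where "w \<in> I" "\<pi> v = \<pi> w" by blast
  then show ?thesis using \<pi>.diff[of v w] \<pi>_zero_iff by auto
qed

definition derived where "derived = G.span {bracketG x y | x y. True}"

lemma bracket_in_derived: "bracketG x y \<in> derived"
  unfolding derived_def by (rule G.span_base) blast

lemma Q_bracket_nonzero: "\<exists>v w. \<pi> (bracketG v w) \<noteq> 0"
proof -
  obtain x y where xy: "bracket x y \<noteq> 0" using Q_simple by (auto simp: Q.simple_def)
  obtain v w where "x = \<pi> v" "y = \<pi> w" using \<pi>_surj by (metis surjD)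
  then show ?thesis using xy \<pi>_bracket by auto
qed

lemma derived_mod_center: "\<exists>w\<in>derived. v - w \<in> G.center"
proof (rule ideal_dichotomy)
  show "G.lie_ideal derived"
    using bracket_in_derived by (simp add: G.lie_ideal_def derived_def)
  obtain v w where "\<pi> (bracketG v w) \<noteq> 0" using Q_bracket_nonzero by blast
  then show "\<not> derived \<subseteq> G.center" using bracket_in_derived \<pi>_zero_iff by blast
qed

lemma span_S_subset_derived: "G.span (\<iota> ` S) \<subseteq> derived"
proof (rule G.span_minimal)
  show "\<iota> ` S \<subseteq> derived"
  proof
    fix x assume "x \<in> \<iota> ` S"
    then obtain \<alpha> where a: "\<alpha> \<in> L.R" "x = \<iota> (L.coroot \<alpha>)"
      using L.S_coroots by (auto simp: L.coroot_def)
    then have "x = bracketG (\<iota> (e \<alpha>)) (\<iota> (e (L.neg \<alpha>)))"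
      using \<iota>_bracket B_lattice(2) L.neg_root by (simp add: L.coroot_def)
    then show "x \<in> derived" using bracket_in_derived by simp
  qed
qed (simp add: derived_def)

lemma R_nonempty: "L.R \<noteq> {}"
proof
  assume "L.R = {}"
  then have BS: "L.B = S" by (simp add: L.B_def)
  have "bracketG (\<iota> s) (\<iota> s') = 0" if "s \<in> S" "s' \<in> S" for s s'
    using bracket_\<iota>_H_S[of s s'] that L.S_H B_lattice(1) by blast
  then have "bracketG x y = 0" for x y
    using G.span_commutes[of "\<iota> ` S" x y] \<iota>_span BS by auto
  then show False using Q_bracket_nonzero \<pi>.zero by simp
qed

section \<open>The reduced Killing form\<close>

text \<open>
  The Killing form itself may vanish modulo 2, so it is divided by the greatest common divisor of
  its values on the lattice before the reduction.
\<close>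

definition D where "D = Gcd {L.zkilling x y | x y. x \<in> L.B \<and> y \<in> L.B}"

definition zform where
  "zform x y = (\<Sum>a\<in>L.B. \<Sum>b\<in>L.B. L.zcrd x a * L.zcrd y b * (L.zkilling a b div D))"

definition form :: "'c \<Rightarrow> 'c \<Rightarrow> 'k" where
  "form v w = (\<Sum>a\<in>L.B. \<Sum>b\<in>L.B. gcrd v a * gcrd w b * of_int (L.zkilling a b div D))"

lemma D_dvd: "a \<in> L.B \<Longrightarrow> b \<in> L.B \<Longrightarrow> D dvd L.zkilling a b"
  unfolding D_def by (rule Gcd_dvd) blast

lemma D_nonzero: "D \<noteq> 0"
proof
  assume D: "D = 0"
  obtain \<alpha> where a: "\<alpha> \<in> L.R" using R_nonempty by blast
  have "D dvd L.k \<alpha>" unfolding L.k_def using a L.neg_root by (intro D_dvd) (auto simp: L.B_def)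
  then show False using D L.k_pos[OF a] by simp
qed

lemma D_primitive: "\<exists>a\<in>L.B. \<exists>b\<in>L.B. odd (L.zkilling a b div D)"
proof (rule ccontr)
  assume "\<not> ?thesis"
  then have "2 * D dvd L.zkilling a b" if "a \<in> L.B" "b \<in> L.B" for a b
    using D_dvd[OF that] that D_nonzero
    by (metis dvd_div_mult_self mult_dvd_mono dvd_refl)
  then have "2 * D dvd Gcd {L.zkilling x y | x y. x \<in> L.B \<and> y \<in> L.B}"
    by (auto intro!: Gcd_greatest)
  then have "2 * D dvd 1 * D" by (simp add: D_def)
  then show False using D_nonzero by (simp only: dvd_mult_cancel_right) simp
qed

lemma killing_zform:
  assumes "x \<in> L.lattice" "y \<in> L.lattice"
  shows "L.killing x y = of_int (D * zform x y)"
proof -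
  have "L.killing x y = L.killing (\<Sum>a\<in>L.B. scaleL (L.crd x a) a) (\<Sum>b\<in>L.B. scaleL (L.crd y b) b)"
    by (simp add: L.crd_expand)
  also have "\<dots> = (\<Sum>a\<in>L.B. \<Sum>b\<in>L.B. L.crd x a * (L.crd y b * L.killing a b))"
    unfolding L.killing_sum_left L.killing_scale_left
    by (simp add: L.killing_sum_right L.killing_scale_right sum_distrib_left)
  also have "\<dots> = (\<Sum>a\<in>L.B. \<Sum>b\<in>L.B.
      of_int (D * (L.zcrd x a * L.zcrd y b * (L.zkilling a b div D))))"
  proof (intro sum.cong refl)
    fix a b assume ab: "a \<in> L.B" "b \<in> L.B"
    have "L.killing a b = of_int (D * (L.zkilling a b div D))"
      using D_dvd[OF ab] L.killing_zkilling[OF ab] by simp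
    then show "L.crd x a * (L.crd y b * L.killing a b) =
        of_int (D * (L.zcrd x a * L.zcrd y b * (L.zkilling a b div D)))"
      using L.crd_zcrd assms by (simp add: mult_ac)
  qed
  also have "\<dots> = of_int (D * zform x y)"
    by (simp only: zform_def sum_distrib_left of_int_sum)
  finally show ?thesis .
qed

lemma zform_eqI:
  assumes "x \<in> L.lattice" "y \<in> L.lattice" "L.killing x y = of_int (D * n)"
  shows "zform x y = n"
proof -
  have "of_int (D * zform x y) = (of_int (D * n) :: 'f)"
    by (rule trans[OF killing_zform[OF assms(1,2), symmetric] assms(3)])
  then have "D * zform x y = D * n" by (simp only: of_int_eq_iff)
  then show ?thesis using D_nonzero by simp
qed

lemma zform_basis: "a \<in> L.B \<Longrightarrow> b \<in> L.B \<Longrightarrow> zform a b = L.zkilling a b div D"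
  using D_dvd[of a b] L.killing_zkilling[of a b] by (intro zform_eqI L.int_span_base) auto

lemma form_\<iota>: "x \<in> L.lattice \<Longrightarrow> y \<in> L.lattice \<Longrightarrow> form (\<iota> x) (\<iota> y) = of_int (zform x y)"
  by (simp add: form_def zform_def gcrd_\<iota>)

lemma form_add_left: "form (u + v) w = form u w + form v w"
  by (simp add: form_def gcrd_add distrib_right sum.distrib)

lemma form_add_right: "form w (u + v) = form w u + form w v"
  by (simp add: form_def gcrd_add distrib_left distrib_right sum.distrib)

lemma form_scale_left: "form (scaleG c v) w = c * form v w"
  by (simp add: form_def gcrd_scale sum_distrib_left mult_ac)

lemma form_scale_right: "form v (scaleG c w) = c * form v w"
  by (simp add: form_def gcrd_scale sum_distrib_left mult_ac)

lemma form_zero_left: "form 0 w = 0"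
  using form_scale_left[of 0 0 w] by simp

lemma form_zero_right: "form w 0 = 0"
  using form_scale_right[of w 0 0] by simp

lemma form_diff_left: "form (u - v) w = form u w - form v w"
  using form_add_left[of "u - v" v w] by simp

lemma form_diff_right: "form w (u - v) = form w u - form w v"
  using form_add_right[of w "u - v" v] by simp

lemma form_sum_left: "form (\<Sum>i\<in>I. f i) w = (\<Sum>i\<in>I. form (f i) w)"
  by (induction I rule: infinite_finite_induct) (auto simp: form_add_left form_zero_left)

lemma form_sum_right: "form w (\<Sum>i\<in>I. f i) = (\<Sum>i\<in>I. form w (f i))"
  by (induction I rule: infinite_finite_induct) (auto simp: form_add_right form_zero_right)

lemma form_expand_right: "form v w = (\<Sum>b\<in>L.B. gcrd w b * form v (\<iota> b))"
  by (subst gcrd_expand[of w, symmetric]) (simp add: form_sum_right form_scale_right)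

lemma form_commute: "form v w = form w v"
proof -
  have "L.zkilling a b = L.zkilling b a" for a b
    by (simp add: L.zkilling_def L.killing_commute[of a b])
  then show ?thesis
    unfolding form_def by (subst sum.swap) (simp add: mult_ac)
qed

lemma form_invariant: "form (bracketG u v) w = form u (bracketG v w)"
proof -
  have basis: "form (bracketG (\<iota> a) (\<iota> b)) (\<iota> c) = form (\<iota> a) (bracketG (\<iota> b) (\<iota> c))"
    if abc: "a \<in> L.B" "b \<in> L.B" "c \<in> L.B" for a b c
  proof -
    have lat: "bracketL a b \<in> L.lattice" "bracketL b c \<in> L.lattice"
      using abc by (auto intro: L.int_span_bracket L.int_span_base)
    have "zform (bracketL a b) c = zform a (bracketL b c)"
      using abc lat L.killing_invariant[of a b c]
      by (intro zform_eqI) (auto simp: killing_zform L.int_span_base)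
    then show ?thesis
      using abc lat by (simp add: form_\<iota> \<iota>_bracket[symmetric] L.int_span_base)
  qed
  note linear = form_sum_left form_sum_right form_scale_left form_scale_right
    G.bracket_sum_left G.bracket_sum_right G.bracket_scale_left G.bracket_scale_right
  have "form (bracketG (\<iota> a) (\<iota> b)) (\<Sum>c\<in>L.B. scaleG (gcrd w c) (\<iota> c)) =
      form (\<iota> a) (bracketG (\<iota> b) (\<Sum>c\<in>L.B. scaleG (gcrd w c) (\<iota> c)))"
    if "a \<in> L.B" "b \<in> L.B" for a b
    using basis that by (simp add: linear)
  then have "form (bracketG (\<iota> a) (\<iota> b)) w = form (\<iota> a) (bracketG (\<iota> b) w)"
    if "a \<in> L.B" "b \<in> L.B" for a b
    using that by (simp add: gcrd_expand)
  then have "form (bracketG (\<iota> a) (\<Sum>b\<in>L.B. scaleG (gcrd v b) (\<iota> b))) w =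
      form (\<iota> a) (bracketG (\<Sum>b\<in>L.B. scaleG (gcrd v b) (\<iota> b)) w)"
    if "a \<in> L.B" for a
    using that by (simp add: linear)
  then have "form (bracketG (\<iota> a) v) w = form (\<iota> a) (bracketG v w)" if "a \<in> L.B" for a
    using that by (simp add: gcrd_expand)
  then have "form (bracketG (\<Sum>a\<in>L.B. scaleG (gcrd u a) (\<iota> a)) v) w =
      form (\<Sum>a\<in>L.B. scaleG (gcrd u a) (\<iota> a)) (bracketG v w)"
    by (simp add: linear)
  then show ?thesis by (simp add: gcrd_expand)
qed

lemma form_root_vectors:
  assumes "\<alpha> \<in> L.R" "\<beta> \<in> L.R" "\<beta> \<noteq> L.neg \<alpha>"
  shows "form (\<iota> (e \<alpha>)) (\<iota> (e \<beta>)) = 0"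
proof -
  have "zform (e \<alpha>) (e \<beta>) = 0"
    using L.killing_root_vectors[OF assms] assms by (intro zform_eqI) (auto simp: B_lattice)
  then show ?thesis using assms by (simp add: form_\<iota> B_lattice)
qed

lemma form_S_root:
  assumes "s \<in> S" "\<alpha> \<in> L.R"
  shows "form (\<iota> s) (\<iota> (e \<alpha>)) = 0"
proof -
  have "s \<in> H" using assms(1) L.S_H by blast
  then have "zform s (e \<alpha>) = 0"
    using L.killing_H_root_vector[of s \<alpha>] assms by (intro zform_eqI) (auto simp: B_lattice)
  then show ?thesis using assms by (simp add: form_\<iota> B_lattice)
qed

definition u where "u \<alpha> = L.k \<alpha> div D"

lemma k_eq: "\<alpha> \<in> L.R \<Longrightarrow> L.k \<alpha> = D * u \<alpha>"
  using D_dvd[of "e \<alpha>" "e (L.neg \<alpha>)"] L.neg_root by (simp add: u_def L.k_def L.B_def)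

lemma form_opposite: "\<alpha> \<in> L.R \<Longrightarrow> form (\<iota> (e \<alpha>)) (\<iota> (e (L.neg \<alpha>))) = of_int (u \<alpha>)"
  using L.neg_root[of \<alpha>] form_\<iota>[OF B_lattice(2) B_lattice(2), of \<alpha> "L.neg \<alpha>"]
  by (simp add: zform_basis L.B_def u_def L.k_def)

lemma central_orthogonal_derived:
  assumes "z \<in> G.center" "d \<in> derived"
  shows "form z d = 0"
  using assms(2) unfolding derived_def
proof (induction rule: G.span_induct_alt)
  case base
  show ?case by (rule form_zero_right)
next
  case (step c x y)
  then obtain v w where "x = bracketG v w" by blast
  then have "form z x = form (bracketG z v) w" by (simp add: form_invariant)
  also have "\<dots> = 0" using assms(1) by (simp add: G.center_def form_zero_left)
  finally show ?case using step by (simp add: form_add_right form_scale_right)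
qed

lemma center_subset_derived: "G.center \<subseteq> derived"
  using center_subset_span_S span_S_subset_derived by blast

text \<open>
  By invariance a central element is orthogonal to all brackets. Modulo the center every element
  is a sum of brackets, and so is a central one, being a combination of coroots.
\<close>

lemma center_orthogonal:
  assumes "z \<in> G.center"
  shows "form z v = 0"
proof -
  obtain w where w: "w \<in> derived" "v - w \<in> G.center" using derived_mod_center by blast
  then have "form z (v - w) = 0" "form z w = 0"
    using assms central_orthogonal_derived center_subset_derived by blast+
  then show ?thesis by (simp add: form_diff_right)
qed

text \<open>
  The radical of an invariant form is an ideal. By simplicity of the quotient it is either
  central or, together with the center, everything; in the second case the form would vanish.
\<close>

lemma radical_eq_center: "(\<forall>w. form v w = 0) \<longleftrightarrow> v \<in> G.center"
proof
  define Rad where "Rad = {v. \<forall>w. form v w = 0}"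
  have ideal: "G.lie_ideal Rad"
    unfolding G.lie_ideal_def
  proof (intro conjI allI ballI)
    show "G.subspace Rad"
      by (auto simp: G.subspace_def Rad_def form_zero_left form_add_left form_scale_left)
    fix x y assume "y \<in> Rad"
    then have "form (bracketG x y) w = 0" for w
      using form_invariant[of y x w] G.bracket_anti[of x y] form_scale_left[of "- 1" "bracketG y x" w]
      by (simp add: Rad_def)
    then show "bracketG x y \<in> Rad" by (simp add: Rad_def)
  qed
  have "Rad \<subseteq> G.center"
  proof (rule ccontr)
    assume "\<not> Rad \<subseteq> G.center"
    then have mod: "\<exists>r\<in>Rad. v - r \<in> G.center" for v using ideal_dichotomy[OF ideal] by blast
    have "form v w = 0" for v w
    proof -
      obtain r where r: "r \<in> Rad" "v - r \<in> G.center" using mod by blast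
      then show ?thesis using center_orthogonal[OF r(2), of w] by (simp add: Rad_def form_diff_left)
    qed
    then have "even (L.zkilling a b div D)" if "a \<in> L.B" "b \<in> L.B" for a b
      using that form_\<iota>[of a b] by (simp add: L.int_span_base zform_basis of_int_mod_2 split: if_splits)
    then show False using D_primitive by blast
  qed
  then show "\<forall>w. form v w = 0 \<Longrightarrow> v \<in> G.center" by (auto simp: Rad_def)
qed (use center_orthogonal in blast)

lemma root_vector_not_central: "\<alpha> \<in> L.R \<Longrightarrow> \<iota> (e \<alpha>) \<notin> G.center"
  using center_root_component[of "\<iota> (e \<alpha>)" \<alpha>] gcrd_basis[of "e \<alpha>" "e \<alpha>"] by (auto simp: L.B_def)

lemma u_odd:
  assumes a: "\<alpha> \<in> L.R"
  shows "odd (u \<alpha>)"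
proof
  assume ev: "even (u \<alpha>)"
  have "form (\<iota> (e \<alpha>)) (\<iota> b) = 0" if "b \<in> L.B" for b
    using that
  proof (cases rule: B_cases)
    case 1
    then show ?thesis using form_S_root[OF 1 a] form_commute by simp
  next
    case (2 \<beta>)
    then show ?thesis
      using form_root_vectors[OF a 2(1)] form_opposite[OF a] ev
      by (cases "\<beta> = L.neg \<alpha>") (auto simp: of_int_mod_2)
  qed
  then have "form (\<iota> (e \<alpha>)) w = 0" for w by (subst form_expand_right) simp
  then show False using radical_eq_center root_vector_not_central[OF a] by blast
qed

text \<open>
  If a root \<open>\<alpha>\<close> vanished modulo 2 on \<open>H\<close>, then as the \<open>u\<close> are odd all Cartan integers of \<open>\<alpha>\<close>
  with other roots would be even, so that \<open>\<alpha>\<close> is orthogonal to all roots but \<open>\<plusminus>\<alpha>\<close>. Its root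
  vector would be central in the quotient.
\<close>

lemma root_nonzero_mod_2:
  assumes a: "\<alpha> \<in> L.R"
  shows "\<exists>s\<in>S. odd (L.cint \<alpha> s)"
proof (rule ccontr)
  assume "\<not> ?thesis"
  then have ev: "even (L.cint \<alpha> s)" if "s \<in> S" for s using that by blast
  have ev1: "even (L.N \<alpha> \<beta>)" if b: "\<beta> \<in> L.R" for \<beta>
    unfolding coroot_combination[OF a b] using ev by (intro even_int_combination) auto
  have ev2: "even (L.N \<beta> \<alpha>)" if b: "\<beta> \<in> L.R" for \<beta>
  proof -
    have "L.N \<alpha> \<beta> * u \<alpha> = L.N \<beta> \<alpha> * u \<beta>"
      using L.N_symmetrized[OF a b] D_nonzero by (simp add: k_eq a b)
    then show ?thesis using ev1[OF b] u_odd[OF b] by (metis even_mult_iff)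
  qed
  have orth: "L.N \<beta> \<alpha> = 0" if "\<beta> \<in> L.R" "\<beta> \<noteq> \<alpha>" "\<beta> \<noteq> L.neg \<alpha>" for \<beta>
    using L.even_cartan_integers_orthogonal(2)[OF a] ev1 ev2 that by blast
  note na = L.neg_root[OF a]
  have "\<pi> (bracketG (\<iota> (e \<alpha>)) (\<iota> b)) = 0" if "b \<in> L.B" for b
    using that
  proof (cases rule: B_cases)
    case 1
    then have "bracketG (\<iota> b) (\<iota> (e \<alpha>)) = 0"
      using bracket_\<iota>_H_root[of b \<alpha>] L.S_H B_lattice(1) a ev by (auto simp: of_int_mod_2)
    then show ?thesis using G.bracket_anti[of "\<iota> (e \<alpha>)" "\<iota> b"] by (simp add: \<pi>.zero)
  next
    case (2 \<beta>)
    note b = 2(1)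
    consider "\<beta> = \<alpha>" | "\<beta> = L.neg \<alpha>" | "\<beta> \<noteq> \<alpha>" "\<beta> \<noteq> L.neg \<alpha>" by blast
    then show ?thesis
    proof cases
      case 1
      then show ?thesis using 2 by (simp add: G.bracket_self \<pi>.zero)
    next
      case 2
      have "bracketG (\<iota> (e \<alpha>)) (\<iota> b) = \<iota> (L.coroot \<alpha>)"
        using \<iota>_bracket[OF B_lattice(2)[OF a] B_lattice(2)[OF na]] 2 \<open>b = e \<beta>\<close> by (simp add: L.coroot_def)
      moreover have "\<iota> (L.coroot \<alpha>) \<in> G.center"
      proof -
        note ct = L.coroot_H[OF a] L.coroot_int[OF a]
        have "bracketG (\<iota> (L.coroot \<alpha>)) (\<iota> c) = 0" if "c \<in> L.B" for c
          using that
        proof (cases rule: B_cases)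
          case 1
          then show ?thesis using bracket_\<iota>_H_S[OF ct] by blast
        next
          case (2 \<gamma>)
          then show ?thesis using bracket_\<iota>_H_root[OF ct] ev2 by (simp add: of_int_mod_2)
        qed
        then have "bracketG (\<iota> (L.coroot \<alpha>)) w = 0" for w
          using G.commutes_with_span[of "\<iota> ` L.B" "\<iota> (L.coroot \<alpha>)" w] \<iota>_span by auto
        then show ?thesis by (simp add: G.center_def)
      qed
      ultimately show ?thesis by (simp add: \<pi>_zero_iff)
    next
      case 3
      let ?\<gamma> = "\<lambda>t. \<alpha> t + \<beta> t"
      have "?\<gamma> \<notin> L.R"
      proof
        assume g: "?\<gamma> \<in> L.R"
        have "of_int (L.N ?\<gamma> \<alpha>) = (of_int (2 + L.N \<beta> \<alpha>) :: 'f)"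
          using L.root_coroot_int[OF g a] L.root_coroot_int[OF b a] L.root_coroot_2[OF a] by simp
        then have "L.N ?\<gamma> \<alpha> = 2" unfolding of_int_eq_iff using orth[OF b 3] by simp
        then have "?\<gamma> = \<alpha> \<or> ?\<gamma> = L.neg \<alpha>" using orth[OF g] by fastforce
        then show False
        proof
          assume "?\<gamma> = \<alpha>"
          then have "\<beta> t = 0" for t by (metis add_cancel_right_right)
          then show False using L.root_nonzero[OF b] by blast
        next
          assume "?\<gamma> = L.neg \<alpha>"
          then have "\<alpha> (L.coroot \<alpha>) + \<beta> (L.coroot \<alpha>) = - \<alpha> (L.coroot \<alpha>)" by meson
          then show False
            using L.root_coroot_int[OF b a] orth[OF b 3] L.root_coroot_2[OF a] by simp
        qed
      qed
      then have "bracketL (e \<alpha>) (e \<beta>) = 0" using L.bracket_nonopposite(2)[OF a b 3(2)] by blast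
      then have "bracketG (\<iota> (e \<alpha>)) (\<iota> b) = 0"
        using \<iota>_bracket[OF B_lattice(2)[OF a] B_lattice(2)[OF b]] \<open>b = e \<beta>\<close> \<iota>_zero by simp
      then show ?thesis by (simp add: \<pi>.zero)
    qed
  qed
  then have "\<pi> (bracketG (\<iota> (e \<alpha>)) w) = 0" for w using bracketG_eqI by blast
  then have "bracket (\<pi> (\<iota> (e \<alpha>))) x = 0" for x using \<pi>_surj \<pi>_bracket by (metis surjD)
  then have "\<pi> (\<iota> (e \<alpha>)) \<in> Q.center" by (simp add: Q.center_def)
  then show False using Q_center \<pi>_zero_iff root_vector_not_central[OF a] by simp
qed

text \<open>
  On the image of \<open>H\<close> the reduced form is alternating, because the form takes the value
  \<open>2 u \<alpha>\<close> at the coroot of \<open>\<alpha>\<close>, and nondegenerate, because \<open>H\<close> is orthogonal to all root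
  vectors.
\<close>

lemma form_alternating_S:
  assumes "v \<in> G.span (\<iota> ` S)"
  shows "form v v = 0"
  using assms
proof (induction rule: G.span_induct_alt)
  case base
  show ?case by (rule form_zero_left)
next
  case (step c x y)
  then obtain s where s: "s \<in> S" "x = \<iota> s" by blast
  then obtain \<alpha> where a: "\<alpha> \<in> L.R" "s = L.coroot \<alpha>" using L.S_coroots by (auto simp: L.coroot_def)
  have "L.killing s s = of_int (D * (2 * u \<alpha>))"
    using L.killing_coroot[OF L.coroot_H[OF a(1)] a(1)] L.root_coroot_2[OF a(1)]
      L.killing_opposite[OF a(1)] k_eq[OF a(1)] by (simp add: a(2))
  then have "zform s s = 2 * u \<alpha>" using s(1) by (intro zform_eqI) (auto simp: B_lattice)
  then have "form x x = 0" using s by (simp add: form_\<iota> B_lattice of_int_mod_2)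
  moreover have "c * form x y + c * form x y = 0"
    using char_2 by (metis mult_2 mult_zero_left)
  ultimately show ?case
    using step.IH form_commute[of y x]
    by (simp add: form_add_left form_add_right form_scale_left form_scale_right)
qed

lemma form_nondegenerate_S:
  assumes v: "v \<in> G.span (\<iota> ` S)" and "v \<notin> G.center"
  shows "\<exists>s\<in>S. form v (\<iota> s) \<noteq> 0"
proof (rule ccontr)
  assume no: "\<not> ?thesis"
  have "form v (\<iota> b) = 0" if "b \<in> L.B" for b
    using that
  proof (cases rule: B_cases)
    case 1
    then show ?thesis using no by blast
  next
    case (2 \<alpha>)
    have "form v (\<iota> (e \<alpha>)) = 0"
      using v by (rule G.bilinear_vanishes_on_span[rotated -1])
        (auto simp: form_add_left form_scale_left form_S_root 2)
    then show ?thesis by (simp add: 2)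
  qed
  then have "form v w = 0" for w by (subst form_expand_right) simp
  then show False using radical_eq_center assms(2) by blast
qed

lemma even_dim_torus: "even (Q.dim (Q.span (\<pi> ` \<iota> ` S)))"
proof -
  let ?U = "Q.span (\<pi> ` \<iota> ` S)"
  have U: "?U = \<pi> ` G.span (\<iota> ` S)" by (rule \<pi>.span_image)
  define lift where "lift = inv \<pi>"
  have lift: "\<pi> (lift x) = x" for x by (simp add: lift_def surj_f_inv_f[OF \<pi>_surj])
  have form_cong: "form v w = form v' w'" if "\<pi> v = \<pi> v'" "\<pi> w = \<pi> w'" for v v' w w'
  proof -
    have "v - v' \<in> G.center" "w - w' \<in> G.center"
      using that \<pi>_zero_iff[symmetric] by (simp_all add: \<pi>.diff)
    then have "form (v - v') w = 0" "form (w - w') v' = 0" using center_orthogonal by blast+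
    then show ?thesis by (simp add: form_diff_left form_commute[of w] form_commute[of w'])
  qed
  let ?\<omega> = "\<lambda>x y. form (lift x) (lift y)"
  show ?thesis
  proof (rule Q.nondegenerate_alternating_even_dim[of "\<pi> ` \<iota> ` S" ?U ?\<omega>])
    fix x y z :: 'a and c :: 'k
    show "?\<omega> (x + y) z = ?\<omega> x z + ?\<omega> y z"
      unfolding form_add_left[symmetric] by (rule form_cong) (simp_all add: lift \<pi>.add)
    show "?\<omega> z (x + y) = ?\<omega> z x + ?\<omega> z y"
      unfolding form_add_right[symmetric] by (rule form_cong) (simp_all add: lift \<pi>.add)
    show "?\<omega> (scale c x) y = c * ?\<omega> x y"
      unfolding form_scale_left[symmetric] by (rule form_cong) (simp_all add: lift \<pi>.scale)
    show "?\<omega> x (scale c y) = c * ?\<omega> x y"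
      unfolding form_scale_right[symmetric] by (rule form_cong) (simp_all add: lift \<pi>.scale)
  next
    fix x assume "x \<in> ?U"
    then obtain v where v: "v \<in> G.span (\<iota> ` S)" "x = \<pi> v" by (auto simp: U)
    have "?\<omega> x x = form v v" by (rule form_cong) (simp_all add: lift v)
    then show "?\<omega> x x = 0" using form_alternating_S v(1) by simp
    assume "x \<noteq> 0"
    then obtain s where s: "s \<in> S" "form v (\<iota> s) \<noteq> 0"
      using form_nondegenerate_S[OF v(1)] \<pi>_zero_iff v(2) by blast
    have "?\<omega> x (\<pi> (\<iota> s)) = form v (\<iota> s)" by (rule form_cong) (simp_all add: lift v)
    moreover have "\<pi> (\<iota> s) \<in> ?U" using s(1) by (simp add: Q.span_base)
    ultimately show "\<exists>y\<in>?U. ?\<omega> x y \<noteq> 0" using s(2) by metis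
  qed (auto simp: L.finite_S)
qed

lemma indep_root_vectors: "Q.indep_family L.R (\<lambda>\<alpha>. \<pi> (\<iota> (e \<alpha>)))"
  unfolding Q.indep_family_def
proof (intro allI impI ballI)
  fix c \<alpha> assume "(\<Sum>\<alpha>\<in>L.R. scale (c \<alpha>) (\<pi> (\<iota> (e \<alpha>)))) = 0" and a: "\<alpha> \<in> L.R"
  then have "\<pi> (\<Sum>\<alpha>\<in>L.R. scaleG (c \<alpha>) (\<iota> (e \<alpha>))) = 0" by (simp add: \<pi>.sum \<pi>.scale)
  then have "gcrd (\<Sum>\<beta>\<in>L.R. scaleG (c \<beta>) (\<iota> (e \<beta>))) (e \<alpha>) = 0"
    using center_root_component[OF _ a] \<pi>_zero_iff by blast
  then have "(\<Sum>\<beta>\<in>L.R. c \<beta> * gcrd (\<iota> (e \<beta>)) (e \<alpha>)) = 0" by (simp add: gcrd_sum gcrd_scale)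
  moreover have "(\<Sum>\<beta>\<in>L.R. c \<beta> * gcrd (\<iota> (e \<beta>)) (e \<alpha>)) = (\<Sum>\<beta>\<in>L.R. if \<beta> = \<alpha> then c \<alpha> else 0)"
    using a L.inj_on_e by (intro sum.cong) (auto simp: gcrd_basis L.B_def dest: inj_onD)
  ultimately show "c \<alpha> = 0" using a L.finite_R by simp
qed

end

text \<open>
  The image of \<open>H\<close> is a torus on which no root vanishes, so its dimension is the toral rank.
\<close>

theorem chevalley_reduction_toral_rank_even:
  fixes scale :: "'k::alg_closed_field \<Rightarrow> 'a::ab_group_add \<Rightarrow> 'a"
  assumes "chevalley_reduction scaleL bracketL H S e scaleG bracketG scale bracket \<iota> \<pi>"
    and "lie_2_algebra scale bracket sq" and "CHAR('k) = 2"
  shows "even (lie_2_algebra.toral_rank scale bracket sq)"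
proof -
  interpret chevalley_reduction scaleL bracketL H S e scaleG bracketG scale bracket \<iota> \<pi>
    by fact
  interpret Q: lie_2_algebra scale bracket sq by fact
  interpret Q: lie_2_algebra_closed scale bracket sq
    by unfold_locales fact
  have "Q.toral_rank = Q.dim (Q.span (\<pi> ` \<iota> ` S))"
  proof (rule Q.toral_rank_eq_dim_split_torus[of _ L.R "\<lambda>\<alpha>. \<pi> (\<iota> (e \<alpha>))"])
    show "bracket x y = 0" if "x \<in> \<pi> ` \<iota> ` S" "y \<in> \<pi> ` \<iota> ` S" for x y
      using that bracket_\<iota>_H_S L.S_H B_lattice(1) \<pi>.zero by (auto simp flip: \<pi>_bracket)
    have weight: "bracket (\<pi> (\<iota> s)) (\<pi> (\<iota> (e \<alpha>))) = scale (of_int (L.cint \<alpha> s)) (\<pi> (\<iota> (e \<alpha>)))"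
      if "s \<in> S" "\<alpha> \<in> L.R" for s \<alpha>
      using bracket_\<iota>_H_root[of s \<alpha>] that L.S_H B_lattice(1) by (auto simp: \<pi>.scale simp flip: \<pi>_bracket)
    then show "bracket x (\<pi> (\<iota> (e \<alpha>))) = 0 \<or> bracket x (\<pi> (\<iota> (e \<alpha>))) = \<pi> (\<iota> (e \<alpha>))"
      if "x \<in> \<pi> ` \<iota> ` S" "\<alpha> \<in> L.R" for x \<alpha>
      using that by (auto simp: of_int_mod_2)
    show "\<exists>x\<in>\<pi> ` \<iota> ` S. bracket x (\<pi> (\<iota> (e \<alpha>))) \<noteq> 0" if a: "\<alpha> \<in> L.R" for \<alpha>
    proof -
      obtain s where "s \<in> S" "odd (L.cint \<alpha> s)" using root_nonzero_mod_2[OF a] by blast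
      moreover have "\<pi> (\<iota> (e \<alpha>)) \<noteq> 0" using root_vector_not_central[OF a] \<pi>_zero_iff by blast
      ultimately show ?thesis using weight[OF _ a] by (auto simp: of_int_mod_2)
    qed
    have "\<pi> ` \<iota> ` S \<union> (\<lambda>\<alpha>. \<pi> (\<iota> (e \<alpha>))) ` L.R = \<pi> ` \<iota> ` L.B" by (auto simp: L.B_def)
    then show "Q.span (\<pi> ` \<iota> ` S \<union> (\<lambda>\<alpha>. \<pi> (\<iota> (e \<alpha>))) ` L.R) = UNIV"
      using \<pi>.span_image[of "\<iota> ` L.B"] \<iota>_span \<pi>_surj by simp
  qed (auto simp: Q_center L.finite_S L.finite_R indep_root_vectors)
  then show ?thesis using even_dim_torus by simp
qed

theorem theorem1:
  assumes "CHAR('k::alg_closed_field) = 2"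
  shows "\<not> (\<exists>X (scale :: 'k \<Rightarrow> 'a::ab_group_add \<Rightarrow> 'a) bracket sq.
           classical_lie_algebra TYPE('l::ab_group_add) TYPE('c::ab_group_add) X scale bracket \<and>
           simple_lie_2_algebra scale bracket sq \<and>
           odd (lie_2_algebra.toral_rank scale bracket sq))"
proof
  assume "\<exists>X (scale :: 'k \<Rightarrow> 'a \<Rightarrow> 'a) bracket sq.
           classical_lie_algebra TYPE('l) TYPE('c) X scale bracket \<and>
           simple_lie_2_algebra scale bracket sq \<and>
           odd (lie_2_algebra.toral_rank scale bracket sq)"
  then obtain X and scale :: "'k \<Rightarrow> 'a \<Rightarrow> 'a" and bracket sq
    where classical: "classical_lie_algebra TYPE('l) TYPE('c) X scale bracket"
      and simple2: "simple_lie_2_algebra scale bracket sq"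
      and odd: "odd (lie_2_algebra.toral_rank scale bracket sq)" by blast
  obtain scaleG :: "'k \<Rightarrow> 'c \<Rightarrow> 'c" and bracketG \<pi>
    where G: "chevalley_algebra TYPE('l) X scaleG bracketG"
      and \<pi>: "Vector_Spaces.linear scaleG scale \<pi>" "\<forall>x y. \<pi> (bracketG x y) = bracket (\<pi> x) (\<pi> y)"
        "surj \<pi>" "{x. \<pi> x = 0} = lie_algebra.center bracketG"
      and Q: "lie_algebra scale bracket"
    using classical unfolding classical_lie_algebra_def by blast
  obtain scaleL :: "complex \<Rightarrow> 'l \<Rightarrow> 'l" and bracketL H a e B \<iota>
    where L: "lie_algebra scaleL bracketL" "lie_algebra.chevalley_basis scaleL bracketL X H a e B"
      and \<iota>: "\<forall>x\<in>lie_algebra.int_span scaleL B. \<forall>y\<in>lie_algebra.int_span scaleL B.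
           \<iota> (x + y) = \<iota> x + \<iota> y \<and> \<iota> (bracketL x y) = bracketG (\<iota> x) (\<iota> y)"
        "inj_on \<iota> B" "\<not> module.dependent scaleG (\<iota> ` B)" "module.span scaleG (\<iota> ` B) = UNIV"
      and G': "lie_algebra scaleG bracketG"
    using G unfolding chevalley_algebra_def by blast
  interpret L: lie_algebra scaleL bracketL by fact
  interpret G: lie_algebra scaleG bracketG by fact
  interpret Q: lie_algebra scale bracket by fact
  define h where "h = (\<lambda>\<alpha>. bracketL (e \<alpha>) (e (\<lambda>t. - \<alpha> t)))"
  define S where "S = (\<lambda>i. h (a i)) ` {1..rank X}"
  have basis: "L.cartan_subalgebra H" "L.root_base H (rank X) a" "B = S \<union> e ` L.roots H"
    "L.independent B" "L.span B = UNIV" "\<forall>\<alpha>\<in>L.roots H. e \<alpha> \<in> L.weight_space H \<alpha>"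
    "\<forall>\<alpha>\<in>L.roots H. h \<alpha> \<in> H \<and> \<alpha> (h \<alpha>) = 2" "\<forall>x\<in>B. \<forall>y\<in>B. bracketL x y \<in> L.int_span B"
    using L(2) unfolding L.chevalley_basis_def Let_def S_def h_def by blast+
  have SR: "S \<subseteq> h ` L.roots H" using basis(2) unfolding S_def L.root_base_def by blast
  interpret lattice: chevalley_lattice scaleL bracketL H S e
    using basis SR by unfold_locales (auto simp: h_def)
  have B: "lattice.B = B" by (simp add: lattice.B_def basis(3))
  have two: "(2 :: 'k) = 0" using of_nat_CHAR[where 'a = 'k] assms by simp
  have "chevalley_reduction scaleL bracketL H S e scaleG bracketG scale bracket \<iota> \<pi>"
  proof (intro chevalley_reduction.intro chevalley_reduction_axioms.intro, unfold B)
    show "chevalley_lattice scaleL bracketL H S e" by unfold_locales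
    show "lie_algebra scaleG bracketG" "lie_algebra scale bracket" by unfold_locales
    show "Q.simple" using simple2 by (simp add: simple_lie_2_algebra_def)
  qed (use \<iota> \<pi> two in blast)+
  moreover have "lie_2_algebra scale bracket sq" using simple2 by (simp add: simple_lie_2_algebra_def)
  ultimately show False
    using chevalley_reduction_toral_rank_even assms odd by blast
qed

end
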